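(* Let $G$ be a connected graph on $n$ vertices with maximum degree $\Delta_G=\Delta$ and minimum degree $\delta_G=\delta$. Then $$\tau_G\geq \max\left\{\frac{1}{\Delta},\ \frac{\Delta+\delta}{\Delta n},\ \frac{\delta(\xi+1)}{\Delta\xi}-2\right\},$$ where $\xi=\max\{|1-\xi_1^G|,\,|1-\xi_{n-1}^G|\}$.
   Context: All graphs are finite, simple and undirected. For a non-complete connected graph $G$, the toughness is $\tau_G=\min\{|S|/\omega_{G-S} : S\subseteq V_G,\ \omega_{G-S}\geq 2\}$, where $\omega_{G-S}$ is the number of connected components of the subgraph $G-S$ obtained by deleting the vertices of $S$; by convention $\tau_{K_n}=\infty$. Let $A_G$ be the adjacency matrix, $D_G$ the diagonal matrix of vertex degrees, $L_G=D_G-A_G$, and $\mathcal{L}_G=D_G^{-1/2}L_GD_G^{-1/2}$ the normalized Laplacian matrix (with $(D_G^{-1/2})_{vv}=0$ for isolated $v$). Its eigenvalues are denoted $\xi_1^G\geq \xi_2^G\geq\cdots\geq \xi_n^G$. *)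

theory Defs
  imports
    "HOL-Library.Extended_Real"
    "Jordan_Normal_Form.Char_Poly"
    "Graph_Theory.Graph_Theory"
begin

text \<open>
  A finite simple undirected graph is a digraph \<open>G\<close> with \<open>graph G\<close>: finite, symmetric, without loops
  and without parallel arcs. Each undirected edge is a pair of opposite arcs, so the degree of
  a vertex is its out-degree.
\<close>

definition max_degree :: "('a, 'b) pre_digraph \<Rightarrow> nat" where
  "max_degree G = Max (out_degree G ` verts G)"

definition min_degree :: "('a, 'b) pre_digraph \<Rightarrow> nat" where
  "min_degree G = Min (out_degree G ` verts G)"

definition components :: "('a, 'b) pre_digraph \<Rightarrow> ('a, 'b) pre_digraph set" where
  "components G = {H. pre_digraph.max_subgraph G Digraph_Component.connected H}"

definition num_components :: "('a, 'b) pre_digraph \<Rightarrow> nat" where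
  "num_components G = card (components G)"

definition del_verts :: "('a, 'b) pre_digraph \<Rightarrow> 'a set \<Rightarrow> ('a, 'b) pre_digraph" where
  "del_verts G S = G \<restriction> (verts G - S)"

text \<open>Meaningful for connected \<open>G\<close> only; if \<open>G\<close> is not complete, the minimum is over a nonempty
  finite set.\<close>

definition toughness :: "('a, 'b) pre_digraph \<Rightarrow> ereal" where
  "toughness G =
     (if complete_digraph (card (verts G)) G then \<infinity>
      else ereal (Min {real (card S) / real (num_components (del_verts G S)) | S.
                         S \<subseteq> verts G \<and> num_components (del_verts G S) \<ge> 2}))"

text \<open>Matrices are indexed by positions in an enumeration \<open>vs\<close> of the vertices.\<close>

definition adjacency_mat :: "('a, 'b) pre_digraph \<Rightarrow> 'a list \<Rightarrow> real mat" where
  "adjacency_mat G vs =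
     mat (length vs) (length vs) (\<lambda>(i, j). if vs ! i \<rightarrow>\<^bsub>G\<^esub> vs ! j then 1 else 0)"

definition degree_mat :: "('a, 'b) pre_digraph \<Rightarrow> 'a list \<Rightarrow> real mat" where
  "degree_mat G vs = mat_diag (length vs) (\<lambda>i. real (out_degree G (vs ! i)))"

definition laplacian_mat :: "('a, 'b) pre_digraph \<Rightarrow> 'a list \<Rightarrow> real mat" where
  "laplacian_mat G vs = degree_mat G vs - adjacency_mat G vs"

definition degree_inv_sqrt_mat :: "('a, 'b) pre_digraph \<Rightarrow> 'a list \<Rightarrow> real mat" where
  "degree_inv_sqrt_mat G vs =
     mat_diag (length vs) (\<lambda>i. if out_degree G (vs ! i) = 0 then 0
                               else 1 / sqrt (real (out_degree G (vs ! i))))"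

definition normalized_laplacian_mat :: "('a, 'b) pre_digraph \<Rightarrow> 'a list \<Rightarrow> real mat" where
  "normalized_laplacian_mat G vs =
     degree_inv_sqrt_mat G vs * laplacian_mat G vs * degree_inv_sqrt_mat G vs"

text \<open>The \<open>i\<close>-th largest real eigenvalue, counted with algebraic multiplicity and starting at
  \<open>i = 1\<close>. For a real symmetric matrix of dimension \<open>n\<close> there are exactly \<open>n\<close> of these.\<close>

definition nth_eigenvalue :: "real mat \<Rightarrow> nat \<Rightarrow> real" where
  "nth_eigenvalue M i = rev (sorted_list_of_multiset (proots (char_poly M))) ! (i - 1)"

end

theory Submission
  imports
    Defs
    "Jordan_Normal_Form.Schur_Decomposition"
    "HOL-Library.Disjoint_Sets"
begin

text \<open>
  Let \<open>S\<close> be a set whose removal leaves \<open>c \<ge> 2\<close> components. Each component sends an edge to \<open>S\<close>, so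
  \<open>c \<le> \<Delta> |S|\<close>; this and vertex counting give the first two bounds. The third adapts to the
  non-regular case the bound \<open>d / \<lambda> - 1\<close> for regular graphs (Brouwer's toughness conjecture, proved
  by Gu). Measuring sets by volume, it suffices to show \<open>c \<delta> (1 - \<xi>) \<le> \<xi> vol S\<close> when
  \<open>0 < \<xi> < 1\<close>, because \<open>vol S \<le> \<Delta> |S|\<close> and \<open>\<delta> \<le> \<Delta>\<close>.

  One vertex from every component gives an independent set, so the Hoffman bound yields
  \<open>c \<delta> (1 + \<xi>) \<le> \<xi> vol V\<close>. If the components send total weight at least \<open>(1 - \<xi>) vol (V - S)\<close> to \<open>S\<close>,
  the expander mixing lemma for the pair \<open>(S, S)\<close> gives \<open>(1 - \<xi>) vol V \<le> (1 + \<xi>) vol S\<close>, and the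
  claim follows. Otherwise some component \<open>C\<close> outweighs the union \<open>R\<close> of all the others. If
  \<open>vol R \<ge> c \<delta>\<close>, mixing for the separated pair \<open>(R, C)\<close> suffices. If \<open>vol R < c \<delta>\<close>, then \<open>R\<close>
  consists of \<open>c - 1\<close> isolated vertices, all of whose edges go to \<open>S\<close>, and mixing for \<open>(R, S)\<close>
  suffices.
\<close>

section \<open>Spectral theorem for real symmetric matrices\<close>

text \<open>Gram-Schmidt applied to a basis beginning with \<open>v\<close> keeps \<open>v\<close>
  in front. Dividing by lengths makes the columns orthonormal and leaves the unit vector
  \<open>v\<close> unchanged.\<close>

lemma orthogonal_mat_with_first_col:
  fixes v :: "real vec"
  assumes v: "v \<in> carrier_vec n" and unit: "v \<bullet> v = 1"
  shows "\<exists>W \<in> carrier_mat n n. transpose_mat W * W = 1\<^sub>m n \<and> col W 0 = v"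
proof -
  have v0: "v \<noteq> 0\<^sub>v n" using unit v by auto
  have n: "n \<noteq> 0" using unit v by (cases n) (auto simp: scalar_prod_def)
  interpret cof_vec_space n "TYPE(real)" .
  define b where "b = basis_completion v"
  define ws where "ws = gram_schmidt n b"
  from basis_completion[OF v v0, folded b_def]
  have dist_b: "distinct b" and indep: "\<not> lin_dep (set b)" and b: "set b \<subseteq> carrier_vec n"
    and hdb: "hd b = v" and len_b: "length b = n" by auto
  from hdb len_b n obtain bs where bv: "b = v # bs" by (cases b, auto)
  from gram_schmidt_result[OF b dist_b indep refl, folded ws_def]
  have ws: "set ws \<subseteq> carrier_vec n" "corthogonal ws" "length ws = n" by (auto simp: len_b)
  from gram_schmidt_hd[OF v, of bs, folded bv] have "hd ws = v" unfolding ws_def .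
  then have ws0: "ws ! 0 = v" using ws(3) n by (cases ws) auto
  have wsc: "ws ! i \<in> carrier_vec n" if "i < n" for i using ws that by auto
  have orth: "(ws ! i \<bullet> ws ! j = 0) = (i \<noteq> j)" if "i < n" "j < n" for i j
    using corthogonalD[OF ws(2), of i j] that ws(3) by (simp add: conjugate_vec_def)
  define us where "us = map (\<lambda>w. (1 / sqrt (w \<bullet> w)) \<cdot>\<^sub>v w) ws"
  have usi: "us ! i = (1 / sqrt (ws ! i \<bullet> ws ! i)) \<cdot>\<^sub>v (ws ! i)" if "i < n" for i
    using that ws(3) by (simp add: us_def)
  define W where "W = mat_of_cols n us"
  have W: "W \<in> carrier_mat n n" using ws(3) by (auto simp: W_def us_def)
  have colW: "col W i = us ! i" if "i < n" for i
    unfolding W_def using that ws(3) wsc[OF that] usi[OF that]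
    by (intro col_mat_of_cols) (auto simp: us_def)
  have "transpose_mat W * W = 1\<^sub>m n"
  proof (rule eq_matI)
    fix i j assume "i < dim_row (1\<^sub>m n)" "j < dim_col (1\<^sub>m n)"
    then have i: "i < n" and j: "j < n" by auto
    have "(transpose_mat W * W) $$ (i, j) = us ! i \<bullet> us ! j"
      using i j W colW by simp
    also have "\<dots> = (ws ! i \<bullet> ws ! j) / (sqrt (ws ! i \<bullet> ws ! i) * sqrt (ws ! j \<bullet> ws ! j))"
      using wsc[OF i] wsc[OF j] i j by (simp add: usi)
    also have "\<dots> = (if i = j then 1 else 0)"
    proof (cases "i = j")
      case True
      have "ws ! i \<bullet> ws ! i \<ge> 0" by (auto simp: scalar_prod_def intro: sum_nonneg)
      moreover have "ws ! i \<bullet> ws ! i \<noteq> 0" using orth[OF i i] by simp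
      ultimately show ?thesis using True by simp
    qed (use orth[OF i j] in auto)
    finally show "(transpose_mat W * W) $$ (i, j) = 1\<^sub>m n $$ (i, j)" using i j by simp
  qed (use W in auto)
  moreover have "col W 0 = v" using colW[of 0] usi[of 0] n ws0 unit by simp
  ultimately show ?thesis using W by blast
qed

text \<open>Deflation, by induction on the list of roots. A unit eigenvector for the head
  \<open>e\<close> becomes the first column of an orthogonal \<open>W\<close>; then
  \<open>W' * A * W\<close> splits off \<open>e\<close>, and the induction hypothesis diagonalises
  the remaining block. The diagonal keeps the order of \<open>es\<close>, so a sorted list gives
  sorted diagonal entries.\<close>

theorem real_symmetric_mat_diagonalizable:
  fixes A :: "real mat"
  assumes "A \<in> carrier_mat n n" "transpose_mat A = A"
    and "char_poly A = (\<Prod>e \<leftarrow> es. [:- e, 1:])"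
  shows "\<exists>U \<in> carrier_mat n n. transpose_mat U * U = 1\<^sub>m n \<and>
           transpose_mat U * A * U = mat_diag n (\<lambda>i. es ! i)"
  using assms
proof (induction es arbitrary: n A)
  case Nil
  then have "n = 0" using degree_monic_char_poly[of A n] by simp
  then show ?case using Nil(1)
    by (intro bexI[of _ "1\<^sub>m n"]) (auto simp: mat_diag_def intro!: eq_matI)
next
  case (Cons e es)
  note A = Cons.prems(1) and sym = Cons.prems(2)
  have "length (e # es) = n"
    using Cons.prems(3) degree_monic_char_poly[OF A] degree_linear_factors[of uminus "e # es"] by simp
  then obtain k where n: "n = Suc k" by auto
  have "eigenvalue A e" unfolding eigenvalue_root_char_poly[OF A] Cons.prems(3) by simp
  then obtain w where w: "w \<in> carrier_vec n" "w \<noteq> 0\<^sub>v n" "A *\<^sub>v w = e \<cdot>\<^sub>v w"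
    using A unfolding eigenvalue_def eigenvector_def by auto
  have wpos: "w \<bullet> w > 0"
  proof -
    have "w \<bullet> w \<ge> 0" by (auto simp: scalar_prod_def intro: sum_nonneg)
    moreover have "w \<bullet> w \<noteq> 0" using conjugate_square_eq_0_vec[OF w(1)] w(2)
      by (simp add: conjugate_vec_def)
    ultimately show ?thesis by simp
  qed
  define v where "v = (1 / sqrt (w \<bullet> w)) \<cdot>\<^sub>v w"
  have v: "v \<in> carrier_vec n" and vv: "v \<bullet> v = 1" and Av: "A *\<^sub>v v = e \<cdot>\<^sub>v v"
    using w wpos A by (auto simp: v_def mult_mat_vec smult_smult_assoc mult.commute)
  obtain W where W: "W \<in> carrier_mat n n" "transpose_mat W * W = 1\<^sub>m n" "col W 0 = v"
    using orthogonal_mat_with_first_col[OF v vv] by blast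
  define W' where "W' = transpose_mat W"
  have W': "W' \<in> carrier_mat n n" and W'W: "W' * W = 1\<^sub>m n" using W by (auto simp: W'_def)
  have WW': "W * W' = 1\<^sub>m n" using mat_mult_left_right_inverse[OF W' W(1) W'W] .
  define B where "B = W' * A * W"
  have B: "B \<in> carrier_mat n n" using W' A W by (auto simp: B_def)
  have symB: "transpose_mat B = B"
    using W(1) W' A sym by (simp add: B_def transpose_mult[of _ n n _ n] W'_def assoc_mult_mat[of _ n n _ n _ n])
  have colB: "col B 0 = e \<cdot>\<^sub>v unit_vec n 0"
  proof -
    have n0: "0 < n" using n by simp
    have "B = W' * (A * W)" using W(1) W' A by (simp add: B_def assoc_mult_mat[of _ n n _ n _ n])
    then have "col B 0 = W' *\<^sub>v (A *\<^sub>v col W 0)"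
      using col_mult2[OF W' mult_carrier_mat[OF A W(1)] n0] col_mult2[OF A W(1) n0] by simp
    also have "\<dots> = e \<cdot>\<^sub>v (W' *\<^sub>v col W 0)"
      using W' v by (simp add: W(3) Av mult_mat_vec)
    also have "W' *\<^sub>v col W 0 = col (W' * W) 0"
      using col_mult2[OF W' W(1) n0] by simp
    finally show ?thesis using n by (simp add: W'W)
  qed
  have B0: "B $$ (i, 0) = (if i = 0 then e else 0)" if "i < n" for i
    using arg_cong[OF colB, of "\<lambda>x. x $ i"] that B n by (auto simp: unit_vec_def)
  \<comment> \<open>Symmetry turns the zeros below \<open>e\<close> in the first column into zeros
    in the first row, so \<open>B\<close> is block diagonal.\<close>
  have B0': "B $$ (0, i) = (if i = 0 then e else 0)" if "i < n" for i
    using arg_cong[OF symB, of "\<lambda>M. M $$ (i, 0)"] B0[OF that] that B n by auto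
  define B3 where "B3 = mat k k (\<lambda>(i, j). B $$ (Suc i, Suc j))"
  let ?E = "mat 1 1 (\<lambda>_. e)"
  have B3: "B3 \<in> carrier_mat k k" by (simp add: B3_def)
  have Bblock: "B = four_block_mat ?E (0\<^sub>m 1 k) (0\<^sub>m k 1) B3"
    using B n by (intro eq_matI) (auto simp: B3_def B0 B0')
  have symB3: "transpose_mat B3 = B3"
  proof (rule eq_matI)
    fix i j assume ij: "i < dim_row B3" "j < dim_col B3"
    then show "transpose_mat B3 $$ (i, j) = B3 $$ (i, j)"
      using arg_cong[OF symB, of "\<lambda>M. M $$ (Suc i, Suc j)"] B n by (auto simp: B3_def)
  qed (auto simp: B3_def)
  \<comment> \<open>Similarity carries the factorisation over to \<open>B\<close>; cancelling the
    linear factor of the block \<open>?E\<close> leaves the one required for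
    \<open>B3\<close>.\<close>
  have "similar_mat B A"
    unfolding similar_mat_def
    by (intro exI[of _ W'] exI[of _ W] similar_mat_witI[of _ _ n])
       (use W' W W'W WW' A B in \<open>auto simp: B_def\<close>)
  from char_poly_similar[OF this]
  have "char_poly B = [:- e, 1:] * (\<Prod>e \<leftarrow> es. [:- e, 1:])"
    using Cons.prems(3) by simp
  moreover have "char_poly B = char_poly ?E * char_poly B3"
    unfolding Bblock by (rule char_poly_four_block_zeros_col[OF _ _ B3]) auto
  moreover have "char_poly ?E = [:- e, 1:]" by (simp add: char_poly_defs det_def sign_def)
  ultimately have "char_poly B3 = (\<Prod>e \<leftarrow> es. [:- e, 1:])"
    by (metis mult_cancel_left pCons_eq_0_iff zero_neq_one)
  from Cons.IH[OF B3 symB3 this] obtain U where U: "U \<in> carrier_mat k k"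
    "transpose_mat U * U = 1\<^sub>m k" "transpose_mat U * B3 * U = mat_diag k (\<lambda>i. es ! i)" by blast
  define Z where "Z = four_block_mat (1\<^sub>m 1) (0\<^sub>m 1 k) (0\<^sub>m k 1) U"
  have Z: "Z \<in> carrier_mat n n" using U(1) n by (auto simp: Z_def)
  have Zt: "transpose_mat Z = four_block_mat (1\<^sub>m 1) (0\<^sub>m 1 k) (0\<^sub>m k 1) (transpose_mat U)"
    unfolding Z_def by (subst transpose_four_block_mat) (use U(1) in auto)
  have ZZ: "transpose_mat Z * Z = 1\<^sub>m n"
    unfolding Zt unfolding Z_def
    by (subst mult_four_block_mat[of _ 1 1 _ k _ k _ _ 1 _ k])
       (use U in \<open>auto simp: n intro!: eq_matI\<close>)
  have "transpose_mat Z * B = four_block_mat ?E (0\<^sub>m 1 k) (0\<^sub>m k 1) (transpose_mat U * B3)"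
    unfolding Zt Bblock
    by (subst mult_four_block_mat[of _ 1 1 _ k _ k _ _ 1 _ k])
       (use U(1) B3 in \<open>auto\<close>)
  then have "transpose_mat Z * B * Z = four_block_mat ?E (0\<^sub>m 1 k) (0\<^sub>m k 1) (mat_diag k (\<lambda>i. es ! i))"
    unfolding Z_def U(3)[symmetric]
    by (simp, subst mult_four_block_mat[of _ 1 1 _ k _ k _ _ 1 _ k])
       (use U(1) B3 in \<open>auto\<close>)
  also have "\<dots> = mat_diag n (\<lambda>i. (e # es) ! i)"
    by (intro eq_matI) (auto simp: n mat_diag_def nth_Cons')
  finally have ZBZ: "transpose_mat Z * B * Z = mat_diag n (\<lambda>i. (e # es) ! i)" .
  have Zt': "transpose_mat Z \<in> carrier_mat n n" using Z by simp
  note assoc = assoc_mult_mat[of _ n n _ n _ n]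
  have WZt: "transpose_mat (W * Z) = transpose_mat Z * W'"
    using W(1) Z by (simp add: transpose_mult[of _ n n _ n] W'_def)
  have WZ: "W * Z \<in> carrier_mat n n" using W(1) Z by simp
  have "transpose_mat (W * Z) * (W * Z) = transpose_mat Z * ((W' * W) * Z)"
    using W(1) W' Z Zt' by (simp add: WZt assoc)
  then have "transpose_mat (W * Z) * (W * Z) = 1\<^sub>m n" using Z by (simp add: W'W ZZ)
  moreover have "transpose_mat (W * Z) * A * (W * Z) = transpose_mat Z * B * Z"
    using W(1) W' Z Zt' A by (simp add: WZt B_def assoc)
  ultimately show ?case using ZBZ WZ by (intro bexI[of _ "W * Z"]) auto
qed


text \<open>The Hermitian form \<open>q\<close> of an eigenvector \<open>v\<close> equals its own
  conjugate by symmetry, and it is \<open>a\<close> times the positive number \<open>N\<close>, the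
  squared norm of \<open>v\<close>.\<close>

lemma real_symmetric_mat_complex_eigenvalue_real:
  fixes A :: "real mat"
  assumes A: "A \<in> carrier_mat n n" and sym: "transpose_mat A = A"
    and ev: "eigenvalue (map_mat complex_of_real A) a"
  shows "a \<in> \<real>"
proof -
  have symA: "A $$ (j, i) = A $$ (i, j)" if "i < n" "j < n" for i j
    using arg_cong[OF sym, of "\<lambda>M. M $$ (i, j)"] that A by simp
  obtain v where v: "v \<in> carrier_vec n" "v \<noteq> 0\<^sub>v n" "map_mat complex_of_real A *\<^sub>v v = a \<cdot>\<^sub>v v"
    using ev A unfolding eigenvalue_def eigenvector_def by auto
  have row: "(\<Sum>j<n. complex_of_real (A $$ (i, j)) * v $ j) = a * v $ i" if "i < n" for i
    using arg_cong[OF v(3), of "\<lambda>x. x $ i"] that v(1) A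
    by (simp add: scalar_prod_def atLeast0LessThan)
  define q where "q = (\<Sum>i<n. \<Sum>j<n. cnj (v $ i) * complex_of_real (A $$ (i, j)) * v $ j)"
  define N where "N = (\<Sum>i<n. (cmod (v $ i))\<^sup>2)"
  have "q = (\<Sum>i<n. cnj (v $ i) * (\<Sum>j<n. complex_of_real (A $$ (i, j)) * v $ j))"
    by (simp add: q_def sum_distrib_left mult.assoc)
  also have "\<dots> = (\<Sum>i<n. a * complex_of_real ((cmod (v $ i))\<^sup>2))"
  proof (intro sum.cong refl)
    fix i assume "i \<in> {..<n}"
    then have "cnj (v $ i) * (\<Sum>j<n. complex_of_real (A $$ (i, j)) * v $ j) = a * (v $ i * cnj (v $ i))"
      by (simp add: row)
    then show "cnj (v $ i) * (\<Sum>j<n. complex_of_real (A $$ (i, j)) * v $ j) =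
        a * complex_of_real ((cmod (v $ i))\<^sup>2)"
      by (simp only: complex_norm_square)
  qed
  finally have qN: "q = a * complex_of_real N" by (simp add: N_def sum_distrib_left)
  have "cnj q = (\<Sum>i<n. \<Sum>j<n. v $ i * complex_of_real (A $$ (i, j)) * cnj (v $ j))"
    by (simp add: q_def)
  also have "\<dots> = (\<Sum>j<n. \<Sum>i<n. v $ i * complex_of_real (A $$ (i, j)) * cnj (v $ j))"
    by (rule sum.swap)
  also have "\<dots> = q" unfolding q_def
    by (intro sum.cong refl) (simp add: symA mult_ac)
  finally have qr: "cnj q = q" .
  obtain i where i: "i < n" "v $ i \<noteq> 0" using v(1,2) by (metis carrier_vecD eq_vecI index_zero_vec)
  have "N > 0" unfolding N_def by (intro sum_pos2[of _ i]) (use i in auto)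
  then have "a = q / complex_of_real N" using qN by simp
  then have "cnj a = a" using qr by simp
  then show ?thesis by (simp add: complex_eq_iff complex_is_Real_iff)
qed

text \<open>Over the complex numbers the characteristic polynomial splits, and its roots are real.
  It is therefore the image of a product of real linear factors, and embedding the coefficients is
  injective.\<close>

lemma real_symmetric_mat_char_poly_splits:
  fixes A :: "real mat"
  assumes A: "A \<in> carrier_mat n n" and sym: "transpose_mat A = A"
  shows "\<exists>es. char_poly A = (\<Prod>e \<leftarrow> es. [:- e, 1:])"
proof -
  let ?C = "map_mat complex_of_real A"
  have C: "?C \<in> carrier_mat n n" using A by simp
  interpret cr: inj_comm_ring_hom complex_of_real by unfold_locales auto
  interpret cp: map_poly_inj_comm_ring_hom complex_of_real ..
  obtain as where as: "char_poly ?C = (\<Prod>a \<leftarrow> as. [:- a, 1:])"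
    using char_poly_factorized[OF C] by blast
  have real: "a \<in> \<real>" if "a \<in> set as" for a
  proof -
    have "poly (char_poly ?C) a = 0" using that unfolding as
      by (simp add: poly_prod_list prod_list_zero_iff image_iff)
    then show ?thesis
      using real_symmetric_mat_complex_eigenvalue_real[OF A sym] eigenvalue_root_char_poly[OF C] by blast
  qed
  have "map_poly complex_of_real (\<Prod>e \<leftarrow> map Re as. [:- e, 1:]) = (\<Prod>a \<leftarrow> as. [:- a, 1:])"
    using real
  proof (induction as)
    case (Cons a as)
    have "map_poly complex_of_real [:- Re a, 1:] = [:- a, 1:]"
      using Cons.prems by (simp add: map_poly_pCons)
    then show ?case using Cons
      by (simp add: cp.hom_mult o_def del: mult_pCons_left)
  qed simp
  also have "\<dots> = map_poly complex_of_real (char_poly A)"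
    unfolding as[symmetric] by (rule of_real_hom.char_poly_hom[OF A])
  finally show ?thesis by (metis cp.injectivity)
qed

text \<open>Ties the list read by \<open>nth_eigenvalue\<close> to the spectral theorem: sorting
  only permutes the roots. Length \<open>n\<close> makes every index from 1 to \<open>n\<close>
  meaningful.\<close>

lemma real_symmetric_mat_char_poly_eq_prod_sorted:
  fixes A :: "real mat"
  assumes A: "A \<in> carrier_mat n n" and sym: "transpose_mat A = A"
  defines "es \<equiv> rev (sorted_list_of_multiset (proots (char_poly A)))"
  shows "char_poly A = (\<Prod>e \<leftarrow> es. [:- e, 1:])" "length es = n"
proof -
  obtain as where as: "char_poly A = (\<Prod>e \<leftarrow> as. [:- e, 1:])"
    using real_symmetric_mat_char_poly_splits[OF A sym] by blast
  have "proots (\<Prod>e \<leftarrow> as. [:- e, 1::real:]) = mset as"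
  proof (induction as)
    case (Cons a as)
    have "(\<Prod>e \<leftarrow> as. [:- e, 1::real:]) \<noteq> 0" by (auto simp: prod_list_zero_iff)
    then show ?case
      using proots_mult[of "[:- a, 1:]" "\<Prod>e \<leftarrow> as. [:- e, 1::real:]"] Cons.IH by (simp del: mult_pCons_left)
  qed simp
  then have es: "mset es = mset as" by (simp add: es_def as)
  have "(\<Prod>e \<leftarrow> es. [:- e, 1:]) = prod_mset (image_mset (\<lambda>e. [:- e, 1:]) (mset es))"
    by (simp flip: prod_mset_prod_list)
  then show cp: "char_poly A = (\<Prod>e \<leftarrow> es. [:- e, 1:])"
    using as by (simp add: es flip: prod_mset_prod_list)
  show "length es = n"
    using cp degree_monic_char_poly[OF A] degree_linear_factors[of uminus es] by simp
qed

text \<open>In an eigenbasis the form is a weighted sum of squares, and the largest weight gives the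
  upper bound. For the lower bound, orthogonality to the kernel vector removes the coordinate of the
  smallest eigenvalue, so that the second smallest bounds what remains.\<close>

lemma rayleigh_bounds_orthogonal_to_kernel:
  fixes A :: "real mat"
  assumes A: "A \<in> carrier_mat n n" and sym: "transpose_mat A = A" and n: "n \<ge> 2"
    and psd: "\<And>x. x \<in> carrier_vec n \<Longrightarrow> x \<bullet> (A *\<^sub>v x) \<ge> 0"
    and u: "u \<in> carrier_vec n" "u \<noteq> 0\<^sub>v n" "A *\<^sub>v u = 0\<^sub>v n"
    and x: "x \<in> carrier_vec n" "x \<bullet> u = 0"
  shows "nth_eigenvalue A (n - 1) * (x \<bullet> x) \<le> x \<bullet> (A *\<^sub>v x)"
    and "x \<bullet> (A *\<^sub>v x) \<le> nth_eigenvalue A 1 * (x \<bullet> x)"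
proof -
  define es where "es = rev (sorted_list_of_multiset (proots (char_poly A)))"
  note es = real_symmetric_mat_char_poly_eq_prod_sorted[OF A sym, folded es_def]
  have nth: "nth_eigenvalue A i = es ! (i - 1)" for i by (simp add: nth_eigenvalue_def es_def)
  have desc: "es ! j \<le> es ! i" if "i \<le> j" "j < n" for i j
  proof -
    have "sorted (rev es)" by (simp add: es_def)
    then show ?thesis using that es(2) sorted_rev_nth_mono[of es i j] by simp
  qed
  obtain U where U: "U \<in> carrier_mat n n" "transpose_mat U * U = 1\<^sub>m n"
      "transpose_mat U * A * U = mat_diag n (\<lambda>i. es ! i)"
    using real_symmetric_mat_diagonalizable[OF A sym es(1)] by blast
  let ?V = "transpose_mat U"
  have V: "?V \<in> carrier_mat n n" using U(1) by simp
  have UV: "U * ?V = 1\<^sub>m n" using mat_mult_left_right_inverse[OF V U(1) U(2)] .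
  have UVz: "U *\<^sub>v (?V *\<^sub>v z) = z" if "z \<in> carrier_vec n" for z
    using that U(1) V UV by (simp flip: assoc_mult_mat_vec[of _ n n _ n])
  have ip: "(?V *\<^sub>v y) \<bullet> (?V *\<^sub>v z) = y \<bullet> z" if "y \<in> carrier_vec n" "z \<in> carrier_vec n" for y z
    using transpose_vec_mult_scalar[of U n n "?V *\<^sub>v z" y] U(1) V that UVz[OF that(2)]
    by (simp)
  have VA: "?V *\<^sub>v (A *\<^sub>v z) = mat_diag n (\<lambda>i. es ! i) *\<^sub>v (?V *\<^sub>v z)" if z: "z \<in> carrier_vec n" for z
  proof -
    have "?V *\<^sub>v (A *\<^sub>v z) = ?V *\<^sub>v (A *\<^sub>v (U *\<^sub>v (?V *\<^sub>v z)))" using UVz[OF z] by simp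
    also have "\<dots> = (?V * A * U) *\<^sub>v (?V *\<^sub>v z)"
      using U(1) V A z by (simp add: assoc_mult_mat_vec[of _ n n _ n] mult_mat_vec_carrier)
    finally show ?thesis using U(3) by simp
  qed
  have diag: "(mat_diag n (\<lambda>i. es ! i) *\<^sub>v z) $ i = es ! i * z $ i" if "z \<in> carrier_vec n" "i < n" for z i
  proof -
    have "(\<Sum>j = 0..<n. (if i = j then es ! j else 0) * z $ j) = (\<Sum>j = 0..<n. if i = j then es ! i * z $ i else 0)"
      by (intro sum.cong) auto
    then show ?thesis using that by (simp add: mat_diag_def scalar_prod_def)
  qed
  define y where "y = ?V *\<^sub>v x"
  define w where "w = ?V *\<^sub>v u"
  have y: "y \<in> carrier_vec n" and w: "w \<in> carrier_vec n" using V x u by (auto simp: y_def w_def)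
  have xx: "x \<bullet> x = (\<Sum>i<n. (y $ i)\<^sup>2)"
    using ip[OF x(1) x(1)] y by (simp add: y_def[symmetric] scalar_prod_def atLeast0LessThan power2_eq_square)
  have xAx: "x \<bullet> (A *\<^sub>v x) = (\<Sum>i<n. es ! i * (y $ i)\<^sup>2)"
  proof -
    have "x \<bullet> (A *\<^sub>v x) = y \<bullet> (mat_diag n (\<lambda>i. es ! i) *\<^sub>v y)"
      using ip[of x "A *\<^sub>v x"] x(1) A VA[OF x(1)] by (simp add: y_def)
    also have "\<dots> = (\<Sum>i<n. y $ i * (mat_diag n (\<lambda>i. es ! i) *\<^sub>v y) $ i)"
      by (simp add: scalar_prod_def atLeast0LessThan mat_diag_def)
    also have "\<dots> = (\<Sum>i<n. es ! i * (y $ i)\<^sup>2)"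
      by (intro sum.cong refl) (simp add: diag[OF y] power2_eq_square)
    finally show ?thesis .
  qed
  show "x \<bullet> (A *\<^sub>v x) \<le> nth_eigenvalue A 1 * (x \<bullet> x)"
    unfolding xx xAx nth sum_distrib_left
    by (intro sum_mono mult_right_mono) (auto intro: desc)
  show "nth_eigenvalue A (n - 1) * (x \<bullet> x) \<le> x \<bullet> (A *\<^sub>v x)"
  \<comment> \<open>The list descends and is indexed from 0, so \<open>es ! (n - 2)\<close> is the
    second smallest eigenvalue. If it is not positive, semidefiniteness suffices; otherwise the
    kernel is spanned by the last eigenvector.\<close>
  proof (cases "es ! (n - 2) > 0")
    case False
    then have "nth_eigenvalue A (n - 1) * (x \<bullet> x) \<le> 0" unfolding nth xx using n
      by (intro mult_nonpos_nonneg sum_nonneg) (auto simp: numeral_2_eq_2)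
    then show ?thesis using psd[OF x(1)] by linarith
  next
    case True
    \<comment> \<open>The diagonal matrix annihilates \<open>w\<close>, so \<open>w\<close> vanishes
      wherever the diagonal entry is positive.\<close>
    have wi: "w $ i = 0" if "i < n - 1" for i
    proof -
      have "?V *\<^sub>v 0\<^sub>v n = 0\<^sub>v n" using V by (intro eq_vecI) auto
      then have "mat_diag n (\<lambda>i. es ! i) *\<^sub>v w = 0\<^sub>v n" using VA[OF u(1)] u(3) by (simp add: w_def)
      then have "es ! i * w $ i = 0" using diag[OF w, of i] that by simp
      moreover have "es ! i \<ge> es ! (n - 2)" using desc[of i "n - 2"] that n by auto
      ultimately show ?thesis using True by auto
    qed
    have split: "{..<n} = insert (n - 1) {..<n - 1}" using n by auto
    have "U *\<^sub>v 0\<^sub>v n = 0\<^sub>v n" using U(1) by (intro eq_vecI) auto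
    then have w0: "w \<noteq> 0\<^sub>v n" using UVz[OF u(1)] u(2) by (auto simp: w_def)
    have "w $ (n - 1) \<noteq> 0"
    proof
      assume last: "w $ (n - 1) = 0"
      have "w $ i = 0" if "i < n" for i
        using that wi[of i] last by (cases "i = n - 1") auto
      then show False using w0 w by auto
    qed
    \<comment> \<open>Only the last entry of \<open>w\<close> survives, so orthogonality of
      \<open>y\<close> and \<open>w\<close> reduces to this one product.\<close>
    moreover have "y $ (n - 1) * w $ (n - 1) = 0"
    proof -
      have "y \<bullet> w = 0" using ip[OF x(1) u(1)] x(2) by (simp add: y_def w_def)
      then have "(\<Sum>i<n. y $ i * w $ i) = 0" using w by (simp add: scalar_prod_def atLeast0LessThan)
      then show ?thesis unfolding split by (simp add: wi)
    qed
    ultimately have "y $ (n - 1) = 0" by simp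
    moreover have "es ! (n - 2) \<le> es ! i" if "i < n - 1" for i using desc[of i "n - 2"] that n by auto
    ultimately show ?thesis unfolding xx xAx nth sum_distrib_left split
      by (auto intro!: sum_mono mult_right_mono simp: numeral_2_eq_2)
  qed
qed

section \<open>Expander mixing and separators in weighted graphs\<close>

locale weighted_graph =
  fixes V :: "'a set" and a :: "'a \<Rightarrow> 'a \<Rightarrow> real"
  assumes finite_V: "finite V"
    and weight_sym: "a u v = a v u"
    and weight_nonneg: "a u v \<ge> 0"
begin

definition deg :: "'a \<Rightarrow> real" where
  "deg v = (\<Sum>w\<in>V. a v w)"

definition vol :: "'a set \<Rightarrow> real" where
  "vol X = (\<Sum>v\<in>X. deg v)"

text \<open>Ordered pairs are summed, so weight inside \<open>X\<close> enters
  \<open>cut X X\<close> from both ends; this is what makes \<open>cut X V = vol X\<close>.\<close>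

definition cut :: "'a set \<Rightarrow> 'a set \<Rightarrow> real" where
  "cut X Y = (\<Sum>u\<in>X. \<Sum>v\<in>Y. a u v)"

text \<open>The inner product for which the random walk on the graph is self-adjoint;
  \<open>ip f f - form f f\<close> is the Laplacian quadratic form.\<close>

definition ip :: "('a \<Rightarrow> real) \<Rightarrow> ('a \<Rightarrow> real) \<Rightarrow> real" where
  "ip f g = (\<Sum>v\<in>V. deg v * f v * g v)"

definition form :: "('a \<Rightarrow> real) \<Rightarrow> ('a \<Rightarrow> real) \<Rightarrow> real" where
  "form f g = (\<Sum>u\<in>V. \<Sum>v\<in>V. a u v * f u * g v)"

lemma ip_linear:
  "ip (\<lambda>v. f v + f' v) g = ip f g + ip f' g" "ip (\<lambda>v. f v - f' v) g = ip f g - ip f' g"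
  "ip (\<lambda>v. c * f v) g = c * ip f g"
  "ip g (\<lambda>v. f v + f' v) = ip g f + ip g f'" "ip g (\<lambda>v. f v - f' v) = ip g f - ip g f'"
  "ip g (\<lambda>v. c * f v) = c * ip g f"
  by (simp_all add: ip_def algebra_simps sum.distrib sum_subtractf sum_distrib_left)

lemma form_linear:
  "form (\<lambda>v. f v + f' v) g = form f g + form f' g" "form (\<lambda>v. f v - f' v) g = form f g - form f' g"
  "form (\<lambda>v. c * f v) g = c * form f g"
  "form g (\<lambda>v. f v + f' v) = form g f + form g f'" "form g (\<lambda>v. f v - f' v) = form g f - form g f'"
  "form g (\<lambda>v. c * f v) = c * form g f"
  by (simp_all add: form_def algebra_simps sum.distrib sum_subtractf sum_distrib_left)

lemma ip_commute: "ip f g = ip g f"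
  by (simp add: ip_def mult_ac)

lemma form_commute: "form f g = form g f"
  unfolding form_def by (subst sum.swap) (simp add: weight_sym mult_ac)

lemma deg_nonneg: "deg v \<ge> 0"
  by (simp add: deg_def sum_nonneg weight_nonneg)

lemma vol_nonneg: "vol X \<ge> 0"
  by (simp add: vol_def sum_nonneg deg_nonneg)

lemma cut_nonneg: "cut X Y \<ge> 0"
  by (simp add: cut_def sum_nonneg weight_nonneg)

lemma ip_self_nonneg: "ip f f \<ge> 0"
  by (simp add: ip_def sum_nonneg deg_nonneg mult.assoc)

lemma cut_commute: "cut X Y = cut Y X"
  unfolding cut_def by (subst sum.swap) (simp add: weight_sym)

lemma cut_V: "cut X V = vol X"
  by (simp add: cut_def vol_def deg_def)

lemma sum_of_bool_mult:
  assumes "X \<subseteq> V"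
  shows "(\<Sum>v\<in>V. of_bool (v \<in> X) * h v) = (\<Sum>v\<in>X. h v :: real)"
  using assms finite_V by (intro sum.mono_neutral_cong_right) auto

lemma ip_indicator:
  assumes "X \<subseteq> V" "Y \<subseteq> V"
  shows "ip (\<lambda>v. of_bool (v \<in> X)) (\<lambda>v. of_bool (v \<in> Y)) = vol (X \<inter> Y)"
proof -
  have "ip (\<lambda>v. of_bool (v \<in> X)) (\<lambda>v. of_bool (v \<in> Y)) = (\<Sum>v\<in>V. of_bool (v \<in> X \<inter> Y) * deg v)"
    unfolding ip_def by (intro sum.cong) auto
  then show ?thesis using sum_of_bool_mult[of "X \<inter> Y" deg] assms by (auto simp: vol_def)
qed

lemma form_indicator:
  assumes "X \<subseteq> V" "Y \<subseteq> V"
  shows "form (\<lambda>v. of_bool (v \<in> X)) (\<lambda>v. of_bool (v \<in> Y)) = cut X Y"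
proof -
  have "form (\<lambda>v. of_bool (v \<in> X)) (\<lambda>v. of_bool (v \<in> Y))
      = (\<Sum>u\<in>V. of_bool (u \<in> X) * (\<Sum>v\<in>V. of_bool (v \<in> Y) * a u v))"
    unfolding form_def sum_distrib_left by (intro sum.cong) auto
  then show ?thesis by (simp only: sum_of_bool_mult[OF assms(1)] sum_of_bool_mult[OF assms(2)] cut_def)
qed

lemma vol_Un: "X \<subseteq> V \<Longrightarrow> Y \<subseteq> V \<Longrightarrow> X \<inter> Y = {} \<Longrightarrow> vol (X \<union> Y) = vol X + vol Y"
  unfolding vol_def using finite_V by (intro sum.union_disjoint) (auto intro: finite_subset)

lemma cut_Un: "Y \<subseteq> V \<Longrightarrow> Z \<subseteq> V \<Longrightarrow> Y \<inter> Z = {} \<Longrightarrow> cut X (Y \<union> Z) = cut X Y + cut X Z"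
  unfolding cut_def sum.distrib[symmetric] using finite_V
  by (intro sum.cong refl sum.union_disjoint) (auto intro: finite_subset)

lemma cut_eq_0: "(\<And>u v. u \<in> X \<Longrightarrow> v \<in> Y \<Longrightarrow> a u v = 0) \<Longrightarrow> cut X Y = 0"
  by (simp add: cut_def)

lemma vol_ge_card:
  assumes "X \<subseteq> V" "\<And>v. v \<in> V \<Longrightarrow> deg v \<ge> d"
  shows "vol X \<ge> real (card X) * d"
  unfolding vol_def using assms by (intro sum_bounded_below) auto

lemma vol_le_card:
  assumes "X \<subseteq> V" "\<And>v. v \<in> V \<Longrightarrow> deg v \<le> d"
  shows "vol X \<le> real (card X) * d"
  unfolding vol_def using assms by (intro sum_bounded_above) auto

end

section \<open>Expander mixing from a spectral gap\<close>

locale expander = weighted_graph +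
  fixes \<xi> :: real
  assumes xi_pos: "\<xi> > 0"
    and vol_pos: "vol V > 0"
    and spectral_gap: "(\<Sum>v\<in>V. deg v * f v) = 0 \<Longrightarrow> \<bar>form f f\<bar> \<le> \<xi> * ip f f"
begin

abbreviation balanced :: "('a \<Rightarrow> real) \<Rightarrow> bool" where
  "balanced f \<equiv> (\<Sum>v\<in>V. deg v * f v) = 0"

text \<open>\<open>spectral_gap\<close> confines the nontrivial eigenvalues of the random walk to
  absolute value at most \<xi>, expressed through quadratic forms. Polarisation extends it to pairs:
  compare \<open>f + t * g\<close> with \<open>f - t * g\<close> and choose the best
  \<open>t\<close>.\<close>

lemma form_square_le:
  assumes f: "balanced f" and g: "balanced g"
  shows "(form f g)\<^sup>2 \<le> \<xi>\<^sup>2 * (ip f f * ip g g)"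
proof -
  have scaled: "2 * t * form f g \<le> \<xi> * (ip f f + t\<^sup>2 * ip g g)" for t
  proof -
    have "\<bar>form (\<lambda>v. f v + t * g v) (\<lambda>v. f v + t * g v)\<bar> \<le> \<xi> * ip (\<lambda>v. f v + t * g v) (\<lambda>v. f v + t * g v)"
    proof (rule spectral_gap)
      have "(\<Sum>v\<in>V. deg v * (f v + t * g v)) = (\<Sum>v\<in>V. deg v * f v) + t * (\<Sum>v\<in>V. deg v * g v)"
        by (simp add: algebra_simps sum.distrib sum_distrib_left)
      then show "balanced (\<lambda>v. f v + t * g v)" using f g by simp
    qed
    moreover have "\<bar>form (\<lambda>v. f v - t * g v) (\<lambda>v. f v - t * g v)\<bar> \<le> \<xi> * ip (\<lambda>v. f v - t * g v) (\<lambda>v. f v - t * g v)"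
    proof (rule spectral_gap)
      have "(\<Sum>v\<in>V. deg v * (f v - t * g v)) = (\<Sum>v\<in>V. deg v * f v) - t * (\<Sum>v\<in>V. deg v * g v)"
        by (simp add: algebra_simps sum_subtractf sum_distrib_left)
      then show "balanced (\<lambda>v. f v - t * g v)" using f g by simp
    qed
    ultimately have "form (\<lambda>v. f v + t * g v) (\<lambda>v. f v + t * g v) - form (\<lambda>v. f v - t * g v) (\<lambda>v. f v - t * g v)
        \<le> \<xi> * ip (\<lambda>v. f v + t * g v) (\<lambda>v. f v + t * g v) + \<xi> * ip (\<lambda>v. f v - t * g v) (\<lambda>v. f v - t * g v)"
      by linarith
    then show ?thesis
      by (simp add: form_linear ip_linear form_commute[of g f] ip_commute[of g f] algebra_simps power2_eq_square)
  qed
  show ?thesis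
  proof (cases "ip g g = 0")
    case True
    have "form f g = 0"
    proof (rule ccontr)
      assume nz: "form f g \<noteq> 0"
      \<comment> \<open>With \<open>ip g g = 0\<close> the right side of \<open>scaled\<close> does
        not depend on \<open>t\<close>; this \<open>t\<close> makes the left side exceed it by
        1.\<close>
      show False using scaled[of "(\<xi> * ip f f + 1) / (2 * form f g)"] nz True by simp
    qed
    then show ?thesis using ip_self_nonneg by simp
  next
    case False
    then have G: "ip g g > 0" using ip_self_nonneg[of g] by simp
    \<comment> \<open>The choice \<open>t = form f g / (\<xi> * ip g g)\<close> maximises the left
      side of \<open>scaled\<close> minus its right side.\<close>
    have "2 * (form f g)\<^sup>2 / (\<xi> * ip g g) \<le> \<xi> * ip f f + (form f g)\<^sup>2 / (\<xi> * ip g g)"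
      using scaled[of "form f g / (\<xi> * ip g g)"] G xi_pos by (simp add: field_simps power2_eq_square)
    then have "(form f g)\<^sup>2 / (\<xi> * ip g g) \<le> \<xi> * ip f f" by simp
    then show ?thesis using G xi_pos by (simp add: field_simps power2_eq_square)
  qed
qed

text \<open>\<open>form_square_le\<close> is applied to indicators made balanced by subtracting a
  constant, and scaled by \<open>vol V\<close> to avoid division. A factor
  \<open>(vol V)\<^sup>2\<close> then cancels.\<close>

lemma expander_mixing:
  assumes X: "X \<subseteq> V" and Y: "Y \<subseteq> V"
  shows "(vol V * cut X Y - vol X * vol Y)\<^sup>2
          \<le> \<xi>\<^sup>2 * (vol X * (vol V - vol X) * (vol Y * (vol V - vol Y)))"
proof -
  let ?f = "\<lambda>X v. vol V * of_bool (v \<in> X) - vol X * of_bool (v \<in> V)"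
  have bal: "balanced (?f X)" if "X \<subseteq> V" for X
  proof -
    have "(\<Sum>v\<in>V. deg v * ?f X v) = ip (?f X) (\<lambda>v. of_bool (v \<in> V))"
      unfolding ip_def by (intro sum.cong) auto
    also have "\<dots> = 0" using that by (simp only: ip_linear) (simp add: ip_indicator Int_absorb2)
    finally show ?thesis .
  qed
  have "form (?f X) (?f Y) = vol V * (vol V * cut X Y - vol X * vol Y)"
    by (simp only: form_linear)
       (simp add: form_indicator X Y cut_V cut_commute[of V] algebra_simps)
  moreover have "ip (?f X) (?f X) = vol V * (vol X * (vol V - vol X))" if "X \<subseteq> V" for X
    using that by (simp only: ip_linear)
       (simp add: ip_indicator Int_absorb1 Int_absorb2 algebra_simps)
  ultimately have "(vol V)\<^sup>2 * (vol V * cut X Y - vol X * vol Y)\<^sup>2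
      \<le> (vol V)\<^sup>2 * (\<xi>\<^sup>2 * (vol X * (vol V - vol X) * (vol Y * (vol V - vol Y))))"
    using form_square_le[OF bal[OF X] bal[OF Y]] X Y by (simp add: power_mult_distrib power2_eq_square mult_ac)
  then show ?thesis using vol_pos by (simp add: mult_le_cancel_left_pos)
qed

lemma vol_le_V: "X \<subseteq> V \<Longrightarrow> vol X \<le> vol V"
  unfolding vol_def using finite_V by (intro sum_mono2) (auto simp: deg_nonneg)

lemma expander_mixing_self:
  assumes X: "X \<subseteq> V"
  shows "\<bar>vol V * cut X X - (vol X)\<^sup>2\<bar> \<le> \<xi> * (vol X * (vol V - vol X))"
proof -
  have "(vol V * cut X X - (vol X)\<^sup>2)\<^sup>2 \<le> (\<xi> * (vol X * (vol V - vol X)))\<^sup>2"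
    using expander_mixing[OF X X] by (simp add: power2_eq_square mult_ac)
  moreover have "\<xi> * (vol X * (vol V - vol X)) \<ge> 0"
    using xi_pos vol_nonneg vol_le_V[OF X] by simp
  ultimately show ?thesis by (metis abs_le_square_iff abs_of_nonneg)
qed

text \<open>With \<open>cut X Y = 0\<close> the left side of the mixing inequality is
  \<open>(vol X * vol Y)\<^sup>2\<close>, and one factor \<open>vol X * vol Y\<close>
  cancels.\<close>

lemma separated_vol_le:
  assumes X: "X \<subseteq> V" and Y: "Y \<subseteq> V" and "cut X Y = 0"
  shows "vol X * vol Y \<le> \<xi>\<^sup>2 * ((vol V - vol X) * (vol V - vol Y))"
proof (cases "vol X * vol Y = 0")
  case True
  then show ?thesis using vol_le_V[OF X] vol_le_V[OF Y] by (simp only: True) simp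
next
  case False
  then have pos: "vol X * vol Y > 0" using vol_nonneg[of X] vol_nonneg[of Y] by (simp add: less_le)
  have "(vol X * vol Y) * (vol X * vol Y) \<le> (vol X * vol Y) * (\<xi>\<^sup>2 * ((vol V - vol X) * (vol V - vol Y)))"
    using expander_mixing[OF X Y] assms(3) by (simp add: power2_eq_square mult_ac)
  then show ?thesis using pos by (simp only: mult_le_cancel_left_pos)
qed

text \<open>The Hoffman bound in volume form: mixing of \<open>X\<close> with itself leaves
  \<open>vol X \<le> \<xi> * (vol V - vol X)\<close>.\<close>

lemma independent_vol_le:
  assumes X: "X \<subseteq> V" and ind: "cut X X = 0"
  shows "vol X * (1 + \<xi>) \<le> \<xi> * vol V"
proof (cases "vol X = 0")
  case True
  then show ?thesis using xi_pos vol_pos by simp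
next
  case False
  then have pos: "vol X > 0" using vol_nonneg[of X] by simp
  have "vol X * vol X \<le> vol X * (\<xi> * (vol V - vol X))"
    using expander_mixing_self[OF X] ind by (simp add: power2_eq_square mult_ac)
  then have "vol X \<le> \<xi> * (vol V - vol X)" using pos by (simp only: mult_le_cancel_left_pos)
  then show ?thesis by (simp add: algebra_simps)
qed

text \<open>When all weight at \<open>X\<close> ends in \<open>Y\<close>, the discrepancy is
  \<open>vol X * (vol V - vol Y)\<close>. This is also a factor of the right side of the mixing
  inequality, so it cancels once.\<close>

lemma absorbed_vol_le:
  assumes X: "X \<subseteq> V" and Y: "Y \<subseteq> V" and abs: "cut X Y = vol X" and lt: "vol Y < vol V"
  shows "vol X * (vol V - vol Y) \<le> \<xi>\<^sup>2 * (vol Y * (vol V - vol X))"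
proof (cases "vol X = 0")
  case True
  then show ?thesis using vol_nonneg[of Y] vol_pos by simp
next
  case False
  then have "vol X * (vol V - vol Y) > 0" using vol_nonneg[of X] lt by (simp add: less_le)
  moreover have "(vol X * (vol V - vol Y)) * (vol X * (vol V - vol Y))
      \<le> (vol X * (vol V - vol Y)) * (\<xi>\<^sup>2 * (vol Y * (vol V - vol X)))"
    using expander_mixing[OF X Y] abs by (simp add: power2_eq_square algebra_simps)
  ultimately show ?thesis by (simp only: mult_le_cancel_left_pos)
qed

text \<open>Tests the gap on a combination of the two indicators, each weighted by the volume of the
  other set so that the sum is balanced. The cross terms vanish, and the volume of the rest of the
  graph does not enter.\<close>

lemma separated_pair_internal_le:
  assumes X: "X \<subseteq> V" and Y: "Y \<subseteq> V" and disj: "X \<inter> Y = {}" and sep: "cut X Y = 0"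
  shows "(vol Y)\<^sup>2 * cut X X + (vol X)\<^sup>2 * cut Y Y \<le> \<xi> * (vol X * vol Y * (vol X + vol Y))"
proof -
  let ?f = "\<lambda>v. vol Y * of_bool (v \<in> X) - vol X * of_bool (v \<in> Y)"
  have "(\<Sum>v\<in>V. deg v * ?f v) = ip ?f (\<lambda>v. of_bool (v \<in> V))"
    unfolding ip_def by (intro sum.cong) auto
  also have "\<dots> = 0" using X Y by (simp only: ip_linear) (simp add: ip_indicator Int_absorb2)
  finally have "\<bar>form ?f ?f\<bar> \<le> \<xi> * ip ?f ?f" by (rule spectral_gap)
  moreover have "form ?f ?f = (vol Y)\<^sup>2 * cut X X + (vol X)\<^sup>2 * cut Y Y"
    using sep by (simp only: form_linear)
      (simp add: form_indicator X Y cut_commute[of Y X] power2_eq_square)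
  moreover have "ip ?f ?f = vol X * vol Y * (vol X + vol Y)"
  proof -
    have "vol {} = 0" by (simp add: vol_def)
    moreover have "Y \<inter> X = {}" using disj by auto
    ultimately show ?thesis
      by (simp only: ip_linear) (simp add: ip_indicator X Y disj algebra_simps)
  qed
  ultimately show ?thesis by (simp only: abs_le_iff)
qed

end

section \<open>Separators, their components and elementary counts\<close>

locale separator = weighted_graph +
  fixes S :: "'a set" and P :: "'a set set" and d :: real
  assumes S_subset: "S \<subseteq> V"
    and partition: "partition_on (V - S) P"
    and no_edges_between: "C \<in> P \<Longrightarrow> D \<in> P \<Longrightarrow> C \<noteq> D \<Longrightarrow> u \<in> C \<Longrightarrow> v \<in> D \<Longrightarrow> a u v = 0"
    and two_components: "card P \<ge> 2"
    and no_loops: "a v v = 0"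
    and deg_ge: "v \<in> V \<Longrightarrow> deg v \<ge> d"
begin

lemma finite_P: "finite P"
  using two_components card.infinite by fastforce

lemma component_subset: "C \<in> P \<Longrightarrow> C \<subseteq> V - S"
  using partition by (auto simp: partition_on_def)

lemma finite_component: "C \<in> P \<Longrightarrow> finite C"
  using component_subset finite_V by (meson Diff_subset finite_subset)

lemma component_nonempty: "C \<in> P \<Longrightarrow> C \<noteq> {}"
  using partition by (auto simp: partition_on_def)

lemma sum_components: "(\<Sum>v\<in>V - S. h v) = (\<Sum>C\<in>P. \<Sum>v\<in>C. h v)"
proof -
  have "V - S = \<Union>P" using partition by (simp add: partition_on_def)
  then show ?thesis
    using partition finite_component
    by (simp add: partition_on_def disjoint_def sum.Union_disjoint)
qed

text \<open>One vertex is chosen from each component: disjointness makes the choice injective, and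
  two chosen vertices lie in distinct components or coincide. This is the independent set for the
  Hoffman bound.\<close>

lemma transversal:
  obtains I where "I \<subseteq> V" "card I = card P" "cut I I = 0"
proof -
  obtain p where p: "p C \<in> C" if "C \<in> P" for C using component_nonempty by (metis ex_in_conv)
  have "inj_on p P"
  proof (rule inj_onI)
    fix C D assume CD: "C \<in> P" "D \<in> P" "p C = p D"
    then have "C \<inter> D \<noteq> {}" using p by fastforce
    then show "C = D" using CD partition by (auto simp: partition_on_def disjoint_def)
  qed
  moreover have "cut (p ` P) (p ` P) = 0"
  proof (rule cut_eq_0)
    fix u v assume "u \<in> p ` P" "v \<in> p ` P"
    then obtain C D where CD: "C \<in> P" "D \<in> P" "u = p C" "v = p D" by auto
    then show "a u v = 0"
      using no_edges_between[of C D u v] p no_loops by (cases "C = D") auto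
  qed
  moreover have "p ` P \<subseteq> V" using p component_subset by blast
  ultimately show ?thesis using that[of "p ` P"] by (simp add: card_image)
qed

text \<open>Splits the weight at \<open>X\<close> along \<open>S\<close>, \<open>X\<close> and the
  rest. Any \<open>X\<close> detached from the rest is allowed, so that it serves a single component
  as well as a union of components.\<close>

lemma cut_component_S:
  assumes "X \<subseteq> V - S" "cut X (V - S - X) = 0"
  shows "cut X S = vol X - cut X X"
proof -
  have "V = S \<union> (X \<union> (V - S - X))" using S_subset assms(1) by auto
  then have "vol X = cut X (S \<union> (X \<union> (V - S - X)))" by (simp flip: cut_V)
  also have "\<dots> = cut X S + (cut X X + cut X (V - S - X))"
    using S_subset assms(1) by (subst cut_Un; (subst cut_Un)?) auto
  finally show ?thesis using assms(2) by simp
qed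

lemma cut_component_rest:
  assumes "C \<in> P"
  shows "cut C (V - S - C) = 0"
proof (rule cut_eq_0)
  fix u v assume uv: "u \<in> C" "v \<in> V - S - C"
  then obtain D where "D \<in> P" "v \<in> D" using partition by (auto simp: partition_on_def)
  then show "a u v = 0" using no_edges_between[OF assms, of D u v] uv by blast
qed

lemma vol_component_rest:
  assumes "C \<in> P"
  shows "vol (V - S) = vol C + vol (V - S - C)"
proof -
  have "vol (C \<union> (V - S - C)) = vol C + vol (V - S - C)"
    using component_subset[OF assms] by (intro vol_Un) auto
  moreover have "C \<union> (V - S - C) = V - S" using component_subset[OF assms] by auto
  ultimately show ?thesis by simp
qed

text \<open>The cuts \<open>cut C S\<close> add up to the weight entering \<open>S\<close> from
  outside, which is part of \<open>vol S\<close>.\<close>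

lemma card_components_le_vol_S:
  assumes "\<And>C. C \<in> P \<Longrightarrow> cut C S \<ge> 1"
  shows "real (card P) \<le> vol S"
proof -
  have "real (card P) \<le> (\<Sum>C\<in>P. cut C S)" using sum_mono[of P "\<lambda>_. 1" "\<lambda>C. cut C S"] assms by simp
  also have "\<dots> = cut (V - S) S" unfolding cut_def by (rule sum_components[symmetric])
  also have "\<dots> \<le> cut S (V - S) + cut S S" using cut_nonneg[of S S] by (simp add: cut_commute)
  also have "\<dots> = cut S ((V - S) \<union> S)" using S_subset by (intro cut_Un[symmetric]) auto
  also have "\<dots> = vol S" using S_subset by (simp add: Un_absorb2 flip: cut_V)
  finally show ?thesis .
qed

lemma card_components_le_card:
  "card P + card S \<le> card V"
proof -
  have "card P \<le> (\<Sum>C\<in>P. card C)"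
    using sum_mono[of P "\<lambda>_. 1" card] component_nonempty finite_component
    by (simp add: Suc_le_eq card_gt_0_iff)
  also have "\<dots> = card (V - S)" using sum_components[of "\<lambda>_. 1::nat"] by simp
  also have "\<dots> = card V - card S" using S_subset finite_V by (simp add: card_Diff_subset finite_subset)
  finally show ?thesis using card_mono[OF finite_V S_subset] two_components by linarith
qed

text \<open>A one-vertex component would send all its weight to the only vertex of \<open>S\<close>
  and have degree at most 1, against \<open>d \<ge> 2\<close>. So every component has two vertices
  or more, and the vertex of \<open>S\<close> makes the inequality strict.\<close>

lemma card_components_cut_vertex:
  assumes "card S = 1" "d \<ge> 2" and weight_le: "\<And>u v. a u v \<le> 1"
  shows "2 * card P < card V"
proof -
  have "card C \<ge> 2" if C: "C \<in> P" for C
  proof (rule ccontr)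
    assume "\<not> card C \<ge> 2"
    moreover have "card C > 0" using C component_nonempty finite_component by (simp add: card_gt_0_iff)
    ultimately have "card C = 1" by linarith
    then obtain v where v: "C = {v}" by (rule card_1_singletonE)
    have "deg v = cut C S"
      using cut_component_S[OF component_subset[OF C] cut_component_rest[OF C]]
      by (simp add: v vol_def cut_def no_loops)
    also have "\<dots> \<le> (\<Sum>w\<in>S. 1)" unfolding cut_def v using sum_mono[of S "a v" "\<lambda>_. 1"] weight_le by simp
    finally have "deg v \<le> 1" using assms(1) by simp
    moreover have "deg v \<ge> d" using component_subset[OF C] v by (intro deg_ge) auto
    ultimately show False using assms(2) by simp
  qed
  then have "(\<Sum>C\<in>P. 2) \<le> (\<Sum>C\<in>P. card C)" by (intro sum_mono) auto
  also have "\<dots> = card (V - S)" using sum_components[of "\<lambda>_. 1::nat"] by simp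
  also have "\<dots> < card V"
    using assms(1) S_subset finite_V by (intro psubset_card_mono) (auto simp: card_1_singleton_iff)
  finally show ?thesis by (simp add: mult.commute)
qed

end

section \<open>The volume bound for separators in expanders\<close>

locale expander_separator = expander + separator +
  assumes xi_less_1: "\<xi> < 1" and d_pos: "d > 0"
begin

lemma card_components_le: "real (card P) * d * (1 + \<xi>) \<le> \<xi> * vol V"
proof -
  obtain I where I: "I \<subseteq> V" "card I = card P" "cut I I = 0" by (rule transversal)
  have "real (card P) * d * (1 + \<xi>) \<le> vol I * (1 + \<xi>)"
    using vol_ge_card[OF I(1) deg_ge] I(2) xi_pos by (intro mult_right_mono) auto
  then show ?thesis using independent_vol_le[OF I(1,3)] by linarith
qed

lemma vol_V_split: "vol V = vol S + vol (V - S)"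
proof -
  have "vol (S \<union> (V - S)) = vol S + vol (V - S)" using S_subset by (intro vol_Un) auto
  moreover have "S \<union> (V - S) = V" using S_subset by auto
  ultimately show ?thesis by simp
qed

lemma vol_rest_pos: "vol (V - S) > 0"
proof -
  obtain C where C: "C \<in> P" using two_components by fastforce
  then obtain v where v: "v \<in> C" using component_nonempty by auto
  then have vVS: "v \<in> V - S" using component_subset C by auto
  have "real (card (V - S)) * d \<le> vol (V - S)" using deg_ge by (intro vol_ge_card) auto
  moreover have "card (V - S) > 0" using vVS finite_V by (auto simp: card_gt_0_iff)
  ultimately show ?thesis using d_pos by (smt (verit) mult_pos_pos of_nat_0_less_iff)
qed

text \<open>Mixing bounds \<open>cut S S\<close> from below, hence the weight between
  \<open>S\<close> and \<open>V - S\<close> from above. Comparison with the assumed lower bound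
  leaves \<open>(1 - \<xi>) * vol V \<le> (1 + \<xi>) * vol S\<close>, and
  \<open>card_components_le\<close> replaces \<open>vol V\<close> by the number of
  components.\<close>

lemma vol_S_ge_of_sparse_components:
  assumes "cut (V - S) S \<ge> (1 - \<xi>) * vol (V - S)"
  shows "real (card P) * d * (1 - \<xi>) \<le> \<xi> * vol S"
proof -
  let ?T = "V - S"
  have split: "cut S ?T = vol S - cut S S"
  proof -
    have "cut S (S \<union> ?T) = cut S S + cut S ?T" using S_subset by (intro cut_Un) auto
    moreover have "S \<union> ?T = V" using S_subset by auto
    ultimately show ?thesis by (simp add: cut_V)
  qed
  have "vol V * cut S S \<ge> (vol S)\<^sup>2 - \<xi> * (vol S * vol ?T)"
    using expander_mixing_self[OF S_subset] vol_V_split by (simp add: abs_le_iff)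
  then have "vol V * cut S ?T \<le> (1 + \<xi>) * (vol S * vol ?T)"
    unfolding split by (simp add: vol_V_split algebra_simps power2_eq_square)
  moreover have "vol V * ((1 - \<xi>) * vol ?T) \<le> vol V * cut S ?T"
    using assms vol_pos by (simp add: cut_commute[of S])
  ultimately have "(vol V * (1 - \<xi>)) * vol ?T \<le> ((1 + \<xi>) * vol S) * vol ?T"
    by (simp add: mult_ac)
  then have "vol V * (1 - \<xi>) \<le> (1 + \<xi>) * vol S"
    using vol_rest_pos by (simp only: mult_le_cancel_right_pos)
  then have "\<xi> * (vol V * (1 - \<xi>)) \<le> \<xi> * ((1 + \<xi>) * vol S)"
    using xi_pos by (intro mult_left_mono) auto
  moreover have "(1 - \<xi>) * (real (card P) * d * (1 + \<xi>)) \<le> (1 - \<xi>) * (\<xi> * vol V)"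
    using card_components_le xi_less_1 by (intro mult_left_mono) auto
  ultimately have "(1 + \<xi>) * (real (card P) * d * (1 - \<xi>)) \<le> (1 + \<xi>) * (\<xi> * vol S)"
    by (simp add: mult_ac)
  then show ?thesis using xi_pos by (simp only: mult_le_cancel_left_pos)
qed

text \<open>If the components send little weight to \<open>S\<close>, one of them, \<open>C\<close>, has internal weight above
  \<open>\<xi> vol C\<close>. Testing the spectral gap on the balanced combination of \<open>C\<close> and the other
  components then forces \<open>C\<close> to be heavier than all of them together.\<close>

lemma dense_component:
  assumes "cut (V - S) S < (1 - \<xi>) * vol (V - S)"
  obtains C where "C \<in> P" "vol (V - S - C) < vol C"
proof -
  \<comment> \<open>Averaging over the components: the assumed strict inequality between the sums
    must hold for some single \<open>C\<close>.\<close>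
  have "(\<Sum>C\<in>P. cut C S) = cut (V - S) S" unfolding cut_def by (rule sum_components[symmetric])
  moreover have "(\<Sum>C\<in>P. (1 - \<xi>) * vol C) = (1 - \<xi>) * vol (V - S)"
    unfolding vol_def sum_components by (simp add: sum_distrib_left)
  ultimately have "\<not> (\<forall>C\<in>P. (1 - \<xi>) * vol C \<le> cut C S)"
    using assms sum_mono[of P "\<lambda>C. (1 - \<xi>) * vol C" "\<lambda>C. cut C S"] by force
  then obtain C where C: "C \<in> P" and e: "cut C S < (1 - \<xi>) * vol C" by force
  let ?R = "V - S - C"
  have CV: "C \<subseteq> V - S" using component_subset[OF C] .
  have sep: "cut C ?R = 0" by (rule cut_component_rest[OF C])
  have volT: "vol (V - S) = vol C + vol ?R" by (rule vol_component_rest[OF C])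
  have RR: "V - S - ?R = C" using CV by auto
  have cutT: "cut (V - S) S = cut C S + cut ?R S"
  proof -
    have "cut S (C \<union> ?R) = cut S C + cut S ?R" using CV by (intro cut_Un) auto
    moreover have "C \<union> ?R = V - S" using CV by auto
    ultimately show ?thesis by (simp add: cut_commute[of S])
  qed
  have eC: "cut C S = vol C - cut C C" by (rule cut_component_S[OF CV sep])
  have eR: "cut ?R S = vol ?R - cut ?R ?R"
    using cut_component_S[of ?R] sep by (simp add: RR cut_commute[of ?R C])
  have "vol ?R < vol C"
  proof (rule ccontr)
    assume "\<not> vol ?R < vol C"
    then have le: "vol C \<le> vol ?R" by simp
    define r m where "r = vol ?R" and "m = vol C"
    have m: "m > 0"
    proof (rule ccontr)
      assume "\<not> m > 0"
      then have "vol C = 0" using vol_nonneg[of C] by (simp add: m_def)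
      then show False using e cut_nonneg[of C S] by simp
    qed
    have rm: "m \<le> r" using le by (simp add: r_def m_def)
    have gap: "m\<^sup>2 * cut ?R ?R + r\<^sup>2 * cut C C \<le> \<xi> * (r * m * (r + m))"
      using separated_pair_internal_le[of ?R C] CV sep
      by (simp add: r_def m_def cut_commute[of ?R C] Diff_Int_distrib2 inf_commute) blast
    have 1: "cut ?R ?R + cut C C > \<xi> * (r + m)"
      using assms unfolding cutT eC eR volT by (simp add: r_def m_def algebra_simps)
    have 2: "cut C C > \<xi> * m"
      using e unfolding eC by (simp add: m_def algebra_simps)
    \<comment> \<open>The multipliers \<open>m\<^sup>2\<close> and
      \<open>r\<^sup>2 - m\<^sup>2\<close>, nonnegative since \<open>m \<le> r\<close>, combine
      facts 1 and 2 into exactly the left side of \<open>gap\<close>, while the lower bounds add up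
      to its right side.\<close>
    have "m\<^sup>2 * (\<xi> * (r + m)) < m\<^sup>2 * (cut ?R ?R + cut C C)"
      using 1 m by (intro mult_strict_left_mono) auto
    moreover have "(r\<^sup>2 - m\<^sup>2) * (\<xi> * m) \<le> (r\<^sup>2 - m\<^sup>2) * cut C C"
      using 2 rm m by (intro mult_left_mono) (auto intro: power_mono)
    ultimately have "m\<^sup>2 * (\<xi> * (r + m)) + (r\<^sup>2 - m\<^sup>2) * (\<xi> * m) < m\<^sup>2 * cut ?R ?R + r\<^sup>2 * cut C C"
      by (simp add: algebra_simps)
    moreover have "m\<^sup>2 * (\<xi> * (r + m)) + (r\<^sup>2 - m\<^sup>2) * (\<xi> * m) = \<xi> * (r * m * (r + m))"
      by (simp add: algebra_simps power2_eq_square)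
    ultimately show False using gap by linarith
  qed
  then show ?thesis using that C by blast
qed

text \<open>Arithmetic for \<open>r = vol R\<close>, \<open>m = vol C\<close>,
  \<open>s = vol S\<close> and \<open>M = vol V\<close>, where \<open>R\<close> is the union of the
  components other than \<open>C\<close>. Eliminating \<open>m\<close> from \<open>sep\<close>
  bounds \<open>s\<close> below in terms of \<open>r\<close>; the form
  \<open>r \<le> \<xi> * (M - r)\<close> of \<open>rle\<close> controls the denominator
  \<open>r + \<xi>\<^sup>2 * (M - r)\<close>.\<close>

lemma large_rest_bound:
  assumes k: "k \<le> r" and kpos: "0 \<le> k" and rle: "r * (1 + \<xi>) \<le> \<xi> * M" and M: "M > 0"
    and s: "s = M - r - m" and sep: "r * m \<le> \<xi>\<^sup>2 * ((M - r) * (M - m))"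
  shows "k * (1 - \<xi>) \<le> \<xi> * (s :: real)"
proof -
  have r: "0 \<le> r" using k kpos by simp
  have rM: "r < M"
  proof (rule ccontr)
    assume "\<not> r < M"
    then have "M * (1 + \<xi>) \<le> r * (1 + \<xi>)" using xi_pos by (intro mult_right_mono) auto
    then show False using rle M by (simp add: algebra_simps)
  qed
  have q: "r + \<xi>\<^sup>2 * (M - r) > 0" using r rM xi_pos by (simp add: add_nonneg_pos)
  have A: "r * (M - r) * (1 - \<xi>\<^sup>2) \<le> s * (r + \<xi>\<^sup>2 * (M - r))"
    using sep by (simp add: s algebra_simps power2_eq_square)
  have "(r * (1 - \<xi>)) * (r + \<xi>\<^sup>2 * (M - r)) \<le> (r * (1 - \<xi>)) * (\<xi> * (1 + \<xi>) * (M - r))"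
  proof (rule mult_left_mono)
    show "r + \<xi>\<^sup>2 * (M - r) \<le> \<xi> * (1 + \<xi>) * (M - r)"
      using rle by (simp add: algebra_simps power2_eq_square)
  qed (use r xi_less_1 in simp)
  also have "\<dots> = \<xi> * (r * (M - r) * (1 - \<xi>\<^sup>2))"
    by (simp add: algebra_simps power2_eq_square)
  also have "\<dots> \<le> \<xi> * (s * (r + \<xi>\<^sup>2 * (M - r)))" using A xi_pos by (intro mult_left_mono) auto
  finally have "(r * (1 - \<xi>)) * (r + \<xi>\<^sup>2 * (M - r)) \<le> (\<xi> * s) * (r + \<xi>\<^sup>2 * (M - r))"
    by (simp add: mult_ac)
  then have "r * (1 - \<xi>) \<le> \<xi> * s" using q by (simp only: mult_le_cancel_right_pos)
  moreover have "k * (1 - \<xi>) \<le> r * (1 - \<xi>)" using k xi_less_1 by (intro mult_right_mono) auto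
  ultimately show ?thesis by linarith
qed

text \<open>Arithmetic for the case where \<open>R\<close> consists of isolated vertices. By
  \<open>abs\<close>, \<open>s\<close> is at least
  \<open>r * M / (r + \<xi>\<^sup>2 * (M - r))\<close>, which increases with \<open>r\<close>, so
  \<open>r\<close> can be replaced by \<open>k / 2\<close>; then \<open>kle\<close>
  concludes.\<close>

lemma absorbed_rest_bound:
  assumes k: "k \<le> 2 * r" and kpos: "0 < k" and kle: "k * (1 + \<xi>) \<le> \<xi> * M" and M: "M > 0"
    and rM: "r \<le> M" and abs: "r * (M - s) \<le> \<xi>\<^sup>2 * (s * (M - r))"
  shows "k * (1 - \<xi>) \<le> \<xi> * (s :: real)"
proof -
  have r: "0 < r" using k kpos by simp
  have kM: "k < M"
  proof (rule ccontr)
    assume "\<not> k < M"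
    then have "M * (1 + \<xi>) \<le> k * (1 + \<xi>)" using xi_pos by (intro mult_right_mono) auto
    then show False using kle M by (simp add: algebra_simps)
  qed
  \<comment> \<open>Substituting \<open>r = k / 2\<close> turns the lower bound for \<open>s\<close>
    into \<open>k * M / w\<close>.\<close>
  define w where "w = k + \<xi>\<^sup>2 * (2 * M - k)"
  have q: "r + \<xi>\<^sup>2 * (M - r) > 0" using r rM xi_pos by (simp add: add_pos_nonneg)
  have w: "w > 0" using kpos kM by (simp add: w_def add_pos_nonneg)
  have "k * M * (r + \<xi>\<^sup>2 * (M - r)) \<le> r * M * w"
  proof -
    have "k * (\<xi>\<^sup>2 * M\<^sup>2) \<le> 2 * r * (\<xi>\<^sup>2 * M\<^sup>2)" using k by (intro mult_right_mono) auto
    then show ?thesis by (simp add: w_def algebra_simps power2_eq_square)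
  qed
  also have "\<dots> \<le> s * (r + \<xi>\<^sup>2 * (M - r)) * w"
    using abs w by (intro mult_right_mono) (auto simp: algebra_simps)
  finally have "(k * M) * (r + \<xi>\<^sup>2 * (M - r)) \<le> (s * w) * (r + \<xi>\<^sup>2 * (M - r))"
    by (simp add: mult_ac)
  then have 1: "k * M \<le> s * w" using q by (simp only: mult_le_cancel_right_pos)
  have 2: "(1 - \<xi>) * w \<le> \<xi> * M"
  proof -
    \<comment> \<open>Since \<open>w = k * (1 - \<xi>\<^sup>2) + 2 * \<xi>\<^sup>2 * M\<close>,
      multiplying \<open>kle\<close> by \<open>(1 - \<xi>)\<^sup>2\<close> bounds
      \<open>(1 - \<xi>) * w\<close> by \<open>\<xi> * (1 - \<xi>\<^sup>2) * M\<close>.\<close>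
    have "(1 - \<xi>) * ((1 - \<xi>) * (k * (1 + \<xi>))) \<le> (1 - \<xi>) * ((1 - \<xi>) * (\<xi> * M))"
      using kle xi_less_1 by (intro mult_left_mono) auto
    then have "(1 - \<xi>) * w \<le> \<xi> * M - \<xi> ^ 3 * M"
      by (simp add: w_def algebra_simps power2_eq_square power3_eq_cube)
    moreover have "\<xi> ^ 3 * M \<ge> 0" using xi_pos M by simp
    ultimately show ?thesis by linarith
  qed
  have "(k * (1 - \<xi>)) * w \<le> k * (\<xi> * M)" using 2 kpos by (simp add: mult_ac)
  also have "\<dots> \<le> (\<xi> * s) * w" using 1 xi_pos by (simp add: mult_ac)
  finally show ?thesis using w by (simp only: mult_le_cancel_right_pos)
qed

theorem separator_volume:
  "real (card P) * d * (1 - \<xi>) \<le> \<xi> * vol S"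
proof (cases "cut (V - S) S \<ge> (1 - \<xi>) * vol (V - S)")
  case True
  then show ?thesis by (rule vol_S_ge_of_sparse_components)
next
  case False
  then obtain C where C: "C \<in> P" and small: "vol (V - S - C) < vol C"
    using dense_component by force
  let ?R = "V - S - C"
  define k where "k = real (card P) * d"
  have kpos: "k > 0" using d_pos two_components by (simp add: k_def)
  have CV: "C \<subseteq> V - S" using component_subset[OF C] .
  have sep: "cut ?R C = 0" using cut_component_rest[OF C] by (simp add: cut_commute)
  have RV: "?R \<subseteq> V" and CV': "C \<subseteq> V" using CV by auto
  have volT: "vol (V - S) = vol C + vol ?R" by (rule vol_component_rest[OF C])
  have volS: "vol S = vol V - vol ?R - vol C" using vol_V_split volT by simp
  have mix: "vol ?R * vol C \<le> \<xi>\<^sup>2 * ((vol V - vol ?R) * (vol V - vol C))"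
    by (rule separated_vol_le[OF RV CV' sep])
  have partR: "partition_on ?R (P - {C})"
    using partition C by (auto simp: partition_on_def disjoint_def)
  show ?thesis
  proof (cases "k \<le> vol ?R")
    case True
    \<comment> \<open>Otherwise \<open>?R\<close> would exceed \<xi> times the volume of its
      complement, and so would the heavier \<open>C\<close>; the product of the two inequalities
      contradicts \<open>mix\<close>.\<close>
    have "vol ?R * (1 + \<xi>) \<le> \<xi> * vol V"
    proof (rule ccontr)
      assume "\<not> ?thesis"
      then have r: "\<xi> * (vol V - vol ?R) < vol ?R" by (simp add: algebra_simps)
      have "\<xi> * (vol V - vol C) \<le> \<xi> * (vol V - vol ?R)" using small xi_pos by simp
      then have m: "\<xi> * (vol V - vol C) < vol C" using r small by linarith
      have "(\<xi> * (vol V - vol ?R)) * (\<xi> * (vol V - vol C)) < vol ?R * vol C"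
        using r m xi_pos vol_le_V[OF RV] vol_le_V[OF CV'] by (intro mult_strict_mono') auto
      then show False using mix by (simp add: power2_eq_square mult_ac)
    qed
    then show ?thesis
      using large_rest_bound[OF True _ _ vol_pos volS mix] kpos by (simp add: k_def)
  next
    case False
    txt \<open>The other components contain fewer than \<open>card P\<close> vertices, so they are isolated vertices.\<close>
    have card_lt: "card ?R < card P"
    proof -
      have "real (card ?R) * d \<le> vol ?R" using deg_ge by (intro vol_ge_card) auto
      then have "real (card ?R) * d < real (card P) * d" using False by (simp add: k_def)
      then show ?thesis using d_pos by simp
    qed
    have cardP: "card (P - {C}) = card P - 1" using C finite_P by simp
    have card_sum: "card ?R = (\<Sum>D\<in>P - {C}. card D)"
    proof -
      have "?R = \<Union>(P - {C})" using partR by (simp add: partition_on_def)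
      moreover have "card (\<Union>(P - {C})) = (\<Sum>D\<in>P - {C}. card D)"
        using partR finite_component
        by (intro card_Union_disjoint) (auto simp: partition_on_def disjoint_def pairwise_def disjnt_def)
      ultimately show ?thesis by simp
    qed
    have ge1: "card D \<ge> 1" if "D \<in> P - {C}" for D
      using that component_nonempty finite_component by (simp add: Suc_le_eq card_gt_0_iff)
    have card_R_ge: "card P - 1 \<le> card ?R"
      using sum_mono[of "P - {C}" "\<lambda>_. 1" card] ge1 cardP by (simp add: card_sum)
    have single: "card D = 1" if D: "D \<in> P - {C}" for D
    proof (rule ccontr)
      assume "card D \<noteq> 1"
      then have "card D > 1" using ge1[OF D] by simp
      then have "(\<Sum>D\<in>P - {C}. 1) < (\<Sum>D\<in>P - {C}. card D)"
        using D ge1 finite_P by (intro sum_strict_mono_ex1) auto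
      then show False using card_lt cardP card_sum by simp
    qed
    have "cut ?R ?R = 0"
    proof (rule cut_eq_0)
      fix u v assume u: "u \<in> ?R" and v: "v \<in> ?R"
      obtain D E where DE: "D \<in> P - {C}" "u \<in> D" "E \<in> P - {C}" "v \<in> E"
        using u v partR unfolding partition_on_def by blast
      show "a u v = 0"
      proof (cases "D = E")
        case True
        then have "u = v" using DE single[of D] by (metis card_1_singletonE singletonD)
        then show ?thesis by (simp add: no_loops)
      next
        case False
        then show ?thesis using no_edges_between[of D E u v] DE by auto
      qed
    qed
    moreover have "V - S - ?R = C" using CV by auto
    \<comment> \<open>No weight stays inside \<open>?R\<close> or goes to \<open>C\<close>, so all
      of it goes to \<open>S\<close>.\<close>
    ultimately have absorbed: "cut ?R S = vol ?R"
      using cut_component_S[of ?R] sep by auto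
    have "vol S < vol V" using vol_V_split vol_rest_pos by simp
    then have mixRS: "vol ?R * (vol V - vol S) \<le> \<xi>\<^sup>2 * (vol S * (vol V - vol ?R))"
      by (rule absorbed_vol_le[OF RV S_subset absorbed])
    \<comment> \<open>There are at least \<open>card P - 1\<close> vertices in \<open>?R\<close>,
      and \<open>card P \<ge> 2\<close> gives \<open>card P \<le> 2 * (card P - 1)\<close>; this is
      the factor 2 in \<open>absorbed_rest_bound\<close>.\<close>
    have "real (card P) \<le> 2 * real (card ?R)" using card_R_ge two_components by linarith
    then have "k \<le> 2 * (real (card ?R) * d)" using d_pos by (simp add: k_def)
    also have "\<dots> \<le> 2 * vol ?R" using vol_ge_card[OF RV deg_ge] by simp
    finally have k2: "k \<le> 2 * vol ?R" .
    show ?thesis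
      using absorbed_rest_bound[OF k2 kpos _ vol_pos vol_le_V[OF RV] mixRS] card_components_le
      by (simp add: k_def)
  qed
qed

end

section \<open>Components of symmetric digraphs\<close>

lemma (in wf_digraph) strongly_connected_imp_connected:
  assumes "strongly_connected G"
  shows "Digraph_Component.connected G"
proof (rule connectedI)
  show "verts G \<noteq> {}" using assms by (simp add: strongly_connected_def)
  fix u v assume "u \<in> verts G" "v \<in> verts G"
  then have "u \<rightarrow>\<^sup>*\<^bsub>G\<^esub> v" using assms by auto
  then show "u \<rightarrow>\<^sup>*\<^bsub>with_proj (mk_symmetric G)\<^esub> v" by (rule reachable_mk_symmetricI)
qed

lemma arc_mono_connected: "arc_mono Digraph_Component.connected"
  unfolding arc_mono_def
  by (metis spanning_def subgraph_def wf_digraph.connected_spanning_imp_connected)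

context sym_digraph
begin

text \<open>Makes the components accessible through reachability. Induced subgraphs of a symmetric
  digraph are symmetric, so for them weak and strong connectivity agree, and a maximal connected
  subgraph is induced.\<close>

lemma components_eq_sccs: "components G = sccs"
proof -
  have "max_subgraph Digraph_Component.connected H \<longleftrightarrow> max_subgraph strongly_connected H" for H
  proof
    assume H: "max_subgraph Digraph_Component.connected H"
    have ind: "induced_subgraph H G" by (rule induced_subgraphI_arc_mono[OF H arc_mono_connected])
    then interpret H: wf_digraph H by (rule wf_digraphI_induced)
    have "symmetric H" using sym_arcs ind by (rule induced_graph_imp_symmetric)
    then have "strongly_connected H"
      using max_subgraph_prop[OF H] by (rule H.symmetric_connected_imp_strongly_connected)
    moreover have "\<not> strongly_connected H'" if "H \<noteq> H'" "subgraph H H'" "subgraph H' G" for H'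
      using H that wf_digraph.strongly_connected_imp_connected[of H']
      by (auto simp: max_subgraph_def subgraph_def)
    ultimately show "max_subgraph strongly_connected H"
      using H by (intro max_subgraphI) (auto simp: max_subgraph_def)
  next
    assume H: "max_subgraph strongly_connected H"
    then have sub: "subgraph H G" and sc: "strongly_connected H" by (auto simp: max_subgraph_def)
    show "max_subgraph Digraph_Component.connected H"
    proof (rule max_subgraphI)
      show "Digraph_Component.connected H"
        using sub sc wf_digraph.strongly_connected_imp_connected by (auto simp: subgraph_def)
      fix K assume K: "H \<noteq> K" "subgraph H K" "subgraph K G"
      show "\<not> Digraph_Component.connected K"
      proof
        assume con: "Digraph_Component.connected K"
        \<comment> \<open>\<open>K\<close> may contain an arc without its reverse; the subgraph
          induced on its vertices is symmetric and still connected.\<close>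
        let ?K = "G \<restriction> verts K"
        have KK: "subgraph K ?K" by (rule subgraph_induce_subgraphI2[OF K(3)])
        have ind: "induced_subgraph ?K G" using K(3) by (intro induced_induce) (auto simp: subgraph_def)
        then interpret K: wf_digraph ?K by (rule wf_digraphI_induced)
        have "Digraph_Component.connected ?K"
          using con KK arc_mono_connected unfolding arc_mono_def by fastforce
        then have "strongly_connected ?K"
          using induced_graph_imp_symmetric[OF sym_arcs ind]
          by (intro K.symmetric_connected_imp_strongly_connected)
        moreover have "subgraph ?K G" using ind by auto
        moreover have "subgraph H ?K" using K(2) KK by (rule subgraph_trans)
        ultimately have "H = ?K" using H by (auto simp: max_subgraph_def)
        then have "subgraph K H" using KK by simp
        then have "H = K" using K(2) by (auto simp: subgraph_def compatible_def)
        then show False using K(1) by simp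
      qed
    qed (rule sub)
  qed
  then show ?thesis by (simp add: components_def sccs_altdef2)
qed

lemma num_components_eq: "num_components G = card sccs_verts"
  by (simp add: num_components_def components_eq_sccs card_sccs_verts)

lemma partition_on_sccs_verts: "partition_on (verts G) sccs_verts"
proof -
  have "\<Union>sccs_verts = verts G"
  proof
    show "\<Union>sccs_verts \<subseteq> verts G"
      unfolding sccs_verts_def by (blast elim: reachable_in_vertsE)
    show "verts G \<subseteq> \<Union>sccs_verts"
    proof
      fix u assume u: "u \<in> verts G"
      have "{v. u \<rightarrow>\<^sup>* v} \<in> sccs_verts"
        unfolding sccs_verts_conv
        by (rule image_eqI[OF _ induce_reachable_is_in_sccs[OF u]]) simp
      moreover have "u \<in> {v. u \<rightarrow>\<^sup>* v}" using u by simp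
      ultimately show "u \<in> \<Union>sccs_verts" by blast
    qed
  qed
  moreover have "disjoint sccs_verts" using sccs_verts_disjoint by (auto simp: disjoint_def)
  moreover have "{} \<notin> sccs_verts" by (simp add: in_sccs_verts_conv_reachable)
  ultimately show ?thesis by (simp add: partition_on_def)
qed

lemma sccs_verts_closed:
  assumes "C \<in> sccs_verts" "u \<in> C" "u \<rightarrow> v"
  shows "v \<in> C"
proof -
  have "u \<rightarrow>\<^sup>* v" using assms(3) by auto
  then show ?thesis using assms(1,2) symmetric_reachable' unfolding in_sccs_verts_conv_reachable by blast
qed

end

text \<open>A walk from a vertex of \<open>X\<close> to a vertex outside has a step that leaves
  \<open>X\<close>.\<close>

lemma (in wf_digraph) strongly_connected_edge_leaving:
  assumes "strongly_connected G" "X \<subseteq> verts G" "X \<noteq> {}" "X \<noteq> verts G"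
  obtains u w where "u \<in> X" "w \<in> verts G - X" "u \<rightarrow> w"
proof -
  obtain v x where v: "v \<in> X" "x \<in> verts G" "x \<notin> X" using assms(2-4) by blast
  then have "v \<rightarrow>\<^sup>* x" using assms(1,2) by auto
  then have "x \<in> X \<or> (\<exists>u\<in>X. \<exists>w\<in>verts G - X. u \<rightarrow> w)"
  proof (induction rule: reachable_induct)
    case base
    then show ?case using v by simp
  next
    case (step y z)
    then show ?case by (metis DiffI adj_in_verts(2))
  qed
  then show ?thesis using v that by blast
qed

section \<open>Simple graphs as weighted graphs, and their components\<close>

context graph
begin

abbreviation adj_weight :: "'a \<Rightarrow> 'a \<Rightarrow> real" where
  "adj_weight u v \<equiv> of_bool (u \<rightarrow> v)"

lemma adj_sym: "u \<rightarrow> v \<longleftrightarrow> v \<rightarrow> u"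
  using sym_arcs by (auto simp: symmetric_def dest: symD)

sublocale weighted_graph "verts G" adj_weight
  by unfold_locales (simp_all add: adj_sym)

lemma adj_irrefl: "\<not> u \<rightarrow> u"
  using no_loops by (auto simp: arcs_ends_conv)

text \<open>Absence of parallel arcs makes \<open>head G\<close> injective on the out-arcs of
  \<open>u\<close>, so counting arcs counts neighbours.\<close>

lemma deg_eq_out_degree: "deg u = real (out_degree G u)"
proof -
  have "{v \<in> verts G. u \<rightarrow> v} = head G ` out_arcs G u"
    by (auto simp: arcs_ends_conv out_arcs_def)
  moreover have "inj_on (head G) (out_arcs G u)"
    using no_multi_arcs by (auto intro!: inj_onI simp: arc_to_ends_def)
  ultimately have "card {v \<in> verts G. u \<rightarrow> v} = out_degree G u"
    by (simp add: card_image out_degree_def)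
  moreover have "deg u = real (card {v \<in> verts G. u \<rightarrow> v})"
    unfolding deg_def by (simp add: of_bool_def sum.If_cases Int_def)
  ultimately show ?thesis by simp
qed

lemma sym_digraph_del_verts: "sym_digraph (del_verts G S)"
proof -
  have ind: "induced_subgraph (del_verts G S) G"
    unfolding del_verts_def by (intro induced_induce) auto
  then interpret H: wf_digraph "del_verts G S" by (rule wf_digraphI_induced)
  show ?thesis using induced_graph_imp_symmetric[OF sym_arcs ind] by unfold_locales
qed

lemma verts_del_verts: "verts (del_verts G S) = verts G - S"
  by (simp add: del_verts_def)

lemma adj_del_verts:
  "u \<rightarrow>\<^bsub>del_verts G S\<^esub> v \<longleftrightarrow> u \<in> verts G - S \<and> v \<in> verts G - S \<and> u \<rightarrow> v"
  by (auto simp: del_verts_def arcs_ends_conv induce_subgraph_def)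

text \<open>Deleting all but two non-adjacent vertices separates them. Thus the \<open>Min\<close>
  in \<open>toughness\<close> ranges over a nonempty set.\<close>

lemma toughness_set_nonempty:
  assumes "\<not> complete_digraph (card (verts G)) G"
  shows "\<exists>S \<subseteq> verts G. num_components (del_verts G S) \<ge> 2"
proof -
  have "arcs_ends G \<subseteq> {(u, v). (u, v) \<in> verts G \<times> verts G \<and> u \<noteq> v}"
    using adj_irrefl by auto
  moreover have "graph G" by unfold_locales
  ultimately obtain u v where uv: "u \<in> verts G" "v \<in> verts G" "u \<noteq> v" "\<not> u \<rightarrow> v"
    using assms unfolding complete_digraph_def by auto
  define S where "S = verts G - {u, v}"
  let ?H = "del_verts G S"
  interpret H: sym_digraph ?H by (rule sym_digraph_del_verts)
  have verts: "verts ?H = {u, v}" using uv by (auto simp: verts_del_verts S_def)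
  have no_arc: "\<not> x \<rightarrow>\<^bsub>?H\<^esub> y" for x y
    using uv adj_irrefl adj_sym[of u v] by (auto simp: adj_del_verts S_def)
  have "u \<in> \<Union>H.sccs_verts" "v \<in> \<Union>H.sccs_verts"
    using H.partition_on_sccs_verts verts by (auto simp: partition_on_def)
  then obtain C D where CD: "C \<in> H.sccs_verts" "D \<in> H.sccs_verts" "u \<in> C" "v \<in> D" by auto
  have "C \<noteq> D"
  proof
    assume "C = D"
    then have "u \<rightarrow>\<^sup>*\<^bsub>?H\<^esub> v" using CD by (auto simp: H.in_sccs_verts_conv_reachable)
    then have "v = u" by (induction rule: H.reachable_induct) (use no_arc in auto)
    then show False using uv by simp
  qed
  have "finite H.sccs_verts" using finite_elements[OF _ H.partition_on_sccs_verts] verts by simp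
  then have "card {C, D} \<le> card H.sccs_verts" using CD by (intro card_mono) auto
  then have "num_components ?H \<ge> 2" using \<open>C \<noteq> D\<close> by (simp add: H.num_components_eq)
  then show ?thesis by (intro exI[of _ S]) (auto simp: S_def)
qed


lemma separator_components:
  assumes "S \<subseteq> verts G" "num_components (del_verts G S) \<ge> 2"
    and "\<And>v. v \<in> verts G \<Longrightarrow> d \<le> real (out_degree G v)"
  shows "separator (verts G) adj_weight S (pre_digraph.sccs_verts (del_verts G S)) d"
proof -
  let ?H = "del_verts G S"
  interpret H: sym_digraph ?H by (rule sym_digraph_del_verts)
  have part: "partition_on (verts G - S) H.sccs_verts"
    using H.partition_on_sccs_verts by (simp add: verts_del_verts)
  show ?thesis
  proof unfold_locales
    fix C D u v assume CD: "C \<in> H.sccs_verts" "D \<in> H.sccs_verts" "C \<noteq> D" "u \<in> C" "v \<in> D"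
    then have "u \<in> verts G - S" "v \<in> verts G - S" using part by (auto simp: partition_on_def)
    moreover have "v \<notin> C" using H.sccs_verts_disjoint[of C D] CD by auto
    ultimately have "\<not> u \<rightarrow> v" using H.sccs_verts_closed[of C u v] CD by (auto simp: adj_del_verts)
    then show "adj_weight u v = 0" by simp
  qed (use assms part in \<open>auto simp: H.num_components_eq adj_irrefl deg_eq_out_degree\<close>)
qed

text \<open>By connectivity an arc leaves \<open>C\<close>, since a second component keeps
  \<open>C\<close> from being the whole vertex set. The arc cannot end in another component, so it
  ends in \<open>S\<close>.\<close>

lemma component_edge_to_separator:
  assumes con: "strongly_connected G" and S: "S \<subseteq> verts G"
    and two: "num_components (del_verts G S) \<ge> 2"
    and C: "C \<in> pre_digraph.sccs_verts (del_verts G S)"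
  shows "cut C S \<ge> 1"
proof -
  let ?H = "del_verts G S"
  interpret H: sym_digraph ?H by (rule sym_digraph_del_verts)
  have part: "partition_on (verts G - S) H.sccs_verts"
    using H.partition_on_sccs_verts by (simp add: verts_del_verts)
  have "\<exists>D\<in>H.sccs_verts. D \<noteq> C"
  proof (rule ccontr)
    assume "\<not> ?thesis"
    then have "H.sccs_verts \<subseteq> {C}" by auto
    then have "card H.sccs_verts \<le> 1" using card_mono[of "{C}"] by fastforce
    then show False using two by (simp add: H.num_components_eq)
  qed
  then obtain D where D: "D \<in> H.sccs_verts" "D \<noteq> C" by blast
  have CV: "C \<subseteq> verts G - S" "C \<noteq> {}" using part C by (auto simp: partition_on_def)
  moreover have "C \<noteq> verts G"
  proof
    assume "C = verts G"
    moreover have "D \<subseteq> verts G" "D \<noteq> {}" using D part by (auto simp: partition_on_def)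
    ultimately show False using H.sccs_verts_disjoint[of D C] D C by blast
  qed
  ultimately obtain u w where uw: "u \<in> C" "w \<in> verts G - C" "u \<rightarrow> w"
    using strongly_connected_edge_leaving[OF con, of C] by blast
  have "w \<in> S"
  proof (rule ccontr)
    assume "w \<notin> S"
    then have "u \<rightarrow>\<^bsub>?H\<^esub> w" using uw CV by (auto simp: adj_del_verts)
    then show False using H.sccs_verts_closed[OF C, of u w] uw by auto
  qed
  have fin: "finite C" "finite S" using CV S by (auto intro: finite_subset[OF _ finite_verts])
  have "adj_weight u w \<le> (\<Sum>v\<in>S. adj_weight u v)"
    using \<open>w \<in> S\<close> fin by (intro member_le_sum) auto
  also have "\<dots> \<le> cut C S"
    unfolding cut_def using uw fin
    by (intro member_le_sum[where f = "\<lambda>u. \<Sum>v\<in>S. adj_weight u v"]) (auto intro: sum_nonneg)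
  finally show ?thesis using uw by simp
qed

end

section \<open>Spectral gap of the normalized Laplacian\<close>

context graph
begin

text \<open>The sum of \<open>adj_weight u v * (f u - f v)\<^sup>2\<close> over ordered pairs is
  twice this difference.\<close>

lemma ip_minus_form_nonneg: "ip f f - form f f \<ge> 0"
proof -
  have "(\<Sum>u\<in>verts G. \<Sum>v\<in>verts G. adj_weight u v * (f u)\<^sup>2) = ip f f"
    by (simp add: ip_def deg_def sum_distrib_right power2_eq_square mult.assoc)
  moreover from this have "(\<Sum>u\<in>verts G. \<Sum>v\<in>verts G. adj_weight u v * (f v)\<^sup>2) = ip f f"
    by (subst sum.swap) (simp add: adj_sym)
  moreover have "(\<Sum>u\<in>verts G. \<Sum>v\<in>verts G. adj_weight u v * (f u - f v)\<^sup>2) =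
      (\<Sum>u\<in>verts G. \<Sum>v\<in>verts G. adj_weight u v * (f u)\<^sup>2)
      + (\<Sum>u\<in>verts G. \<Sum>v\<in>verts G. adj_weight u v * (f v)\<^sup>2) - 2 * form f f"
    unfolding form_def sum_distrib_left sum.distrib[symmetric] sum_subtractf[symmetric]
    by (intro sum.cong refl) (simp add: power2_eq_square algebra_simps)
  moreover have "(\<Sum>u\<in>verts G. \<Sum>v\<in>verts G. adj_weight u v * (f u - f v)\<^sup>2) \<ge> 0"
    by (intro sum_nonneg) auto
  ultimately show ?thesis by linarith
qed

section \<open>The normalized Laplacian in rescaled coordinates\<close>

context
  fixes vs :: "'a list"
  assumes vs: "distinct vs" "set vs = verts G"
    and deg_pos: "\<And>v. v \<in> verts G \<Longrightarrow> deg v > 0"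
begin

text \<open>The vector D^(1/2) f. This substitution turns \<open>ip\<close> into the Euclidean inner
  product and the form of the normalized Laplacian into that of the ordinary one.\<close>

definition scaled_vec :: "('a \<Rightarrow> real) \<Rightarrow> real vec" where
  "scaled_vec f = vec (length vs) (\<lambda>i. sqrt (deg (vs ! i)) * f (vs ! i))"

lemma sum_over_enum: "(\<Sum>v\<in>verts G. h v) = (\<Sum>i<length vs. h (vs ! i) :: real)"
  using sum.reindex_bij_betw[OF bij_betw_nth[OF vs(1) refl vs(2)[symmetric]], of h] by simp

lemma scaled_vec_carrier: "scaled_vec f \<in> carrier_vec (length vs)"
  by (simp add: scaled_vec_def)

lemma deg_nth_pos: "i < length vs \<Longrightarrow> deg (vs ! i) > 0"
  using deg_pos vs(2) nth_mem by blast

lemma normalized_laplacian_mat_carrier: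
  "normalized_laplacian_mat G vs \<in> carrier_mat (length vs) (length vs)"
  by (rule carrier_matI) (simp_all add: normalized_laplacian_mat_def degree_inv_sqrt_mat_def mat_diag_def)

lemma normalized_laplacian_mat_index:
  assumes i: "i < length vs" and j: "j < length vs"
  shows "normalized_laplacian_mat G vs $$ (i, j) =
    of_bool (i = j) - adj_weight (vs ! i) (vs ! j) / (sqrt (deg (vs ! i)) * sqrt (deg (vs ! j)))"
proof -
  let ?n = "length vs"
  have L: "laplacian_mat G vs \<in> carrier_mat ?n ?n"
    by (rule carrier_matI) (simp_all add: laplacian_mat_def adjacency_mat_def)
  define g where "g = (\<lambda>i. if out_degree G (vs ! i) = 0 then 0 else 1 / sqrt (real (out_degree G (vs ! i))))"
  have g: "g i = 1 / sqrt (deg (vs ! i))" for i by (simp add: g_def deg_eq_out_degree)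
  have "normalized_laplacian_mat G vs = mat_diag ?n g * laplacian_mat G vs * mat_diag ?n g"
    by (simp add: normalized_laplacian_mat_def degree_inv_sqrt_mat_def g_def)
  also have "\<dots> $$ (i, j) = g i * laplacian_mat G vs $$ (i, j) * g j"
    using i j L by (simp add: mat_diag_mult_left[OF L] mat_diag_mult_right[of _ ?n ?n])
  also have "laplacian_mat G vs $$ (i, j) = of_bool (i = j) * deg (vs ! i) - adj_weight (vs ! i) (vs ! j)"
    using i j by (simp add: laplacian_mat_def degree_mat_def adjacency_mat_def mat_diag_def deg_eq_out_degree)
  finally show ?thesis
    using deg_nth_pos[OF i] deg_nth_pos[OF j] by (cases "i = j") (simp_all add: g field_simps)
qed

lemma normalized_laplacian_mat_symmetric:
  "transpose_mat (normalized_laplacian_mat G vs) = normalized_laplacian_mat G vs"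
  by (rule eq_matI) (use normalized_laplacian_mat_carrier in
      \<open>auto simp: normalized_laplacian_mat_index adj_sym\<close>)

lemma normalized_laplacian_mult_scaled_vec:
  assumes i: "i < length vs"
  shows "(normalized_laplacian_mat G vs *\<^sub>v scaled_vec f) $ i =
    sqrt (deg (vs ! i)) * f (vs ! i) - (\<Sum>v\<in>verts G. adj_weight (vs ! i) v * f v) / sqrt (deg (vs ! i))"
proof -
  let ?n = "length vs"
  have "(normalized_laplacian_mat G vs *\<^sub>v scaled_vec f) $ i =
      (\<Sum>j<?n. normalized_laplacian_mat G vs $$ (i, j) * (sqrt (deg (vs ! j)) * f (vs ! j)))"
    using i normalized_laplacian_mat_carrier by (simp add: scaled_vec_def scalar_prod_def atLeast0LessThan)
  also have "\<dots> = (\<Sum>j<?n. (if i = j then sqrt (deg (vs ! i)) * f (vs ! i) else 0)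
      - adj_weight (vs ! i) (vs ! j) * f (vs ! j) / sqrt (deg (vs ! i)))"
  proof (intro sum.cong refl)
    fix j assume "j \<in> {..<?n}"
    then show "normalized_laplacian_mat G vs $$ (i, j) * (sqrt (deg (vs ! j)) * f (vs ! j)) =
      (if i = j then sqrt (deg (vs ! i)) * f (vs ! i) else 0)
      - adj_weight (vs ! i) (vs ! j) * f (vs ! j) / sqrt (deg (vs ! i))"
      using i deg_nth_pos[of j] by (auto simp: normalized_laplacian_mat_index field_simps)
  qed
  finally show ?thesis using i
    by (simp add: sum_subtractf sum_over_enum sum_divide_distrib del: sum_of_bool_mult_eq)
qed

lemma scaled_vec_ip: "scaled_vec f \<bullet> scaled_vec g = ip f g"
proof -
  have "scaled_vec f \<bullet> scaled_vec g = (\<Sum>i<length vs. deg (vs ! i) * f (vs ! i) * g (vs ! i))"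
    unfolding scaled_vec_def scalar_prod_def atLeast0LessThan
    by (intro sum.cong) (auto simp: deg_nonneg real_sqrt_mult_self mult_ac simp flip: mult.assoc)
  then show ?thesis by (simp add: ip_def sum_over_enum)
qed

lemma scaled_vec_rayleigh:
  "scaled_vec f \<bullet> (normalized_laplacian_mat G vs *\<^sub>v scaled_vec f) = ip f f - form f f"
proof -
  let ?N = "normalized_laplacian_mat G vs"
  have "scaled_vec f \<bullet> (?N *\<^sub>v scaled_vec f) = (\<Sum>i<length vs. scaled_vec f $ i * (?N *\<^sub>v scaled_vec f) $ i)"
    using normalized_laplacian_mat_carrier by (simp add: scalar_prod_def atLeast0LessThan)
  also have "\<dots> = (\<Sum>i<length vs. deg (vs ! i) * f (vs ! i) * f (vs ! i)
      - (\<Sum>v\<in>verts G. adj_weight (vs ! i) v * f (vs ! i) * f v))"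
  proof (intro sum.cong refl)
    fix i assume "i \<in> {..<length vs}"
    then have i: "i < length vs" by simp
    define q where "q = (\<Sum>v\<in>verts G. adj_weight (vs ! i) v * f v)"
    define s where "s = sqrt (deg (vs ! i))"
    have s: "s > 0" "s * s = deg (vs ! i)" using deg_nth_pos[OF i] by (auto simp: s_def)
    have "scaled_vec f $ i * (?N *\<^sub>v scaled_vec f) $ i = s * f (vs ! i) * (s * f (vs ! i) - q / s)"
      using i by (simp add: normalized_laplacian_mult_scaled_vec q_def s_def) (simp add: scaled_vec_def)
    also have "\<dots> = deg (vs ! i) * f (vs ! i) * f (vs ! i) - f (vs ! i) * q"
      using s by (simp add: field_simps flip: s(2))
    finally show "scaled_vec f $ i * (?N *\<^sub>v scaled_vec f) $ i = deg (vs ! i) * f (vs ! i) * f (vs ! i)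
      - (\<Sum>v\<in>verts G. adj_weight (vs ! i) v * f (vs ! i) * f v)"
      by (simp add: q_def sum_distrib_left mult_ac del: sum_of_bool_mult_eq sum_mult_of_bool_eq)
  qed
  also have "\<dots> = ip f f - form f f"
    by (simp add: ip_def form_def sum_subtractf sum_over_enum[of "\<lambda>u. deg u * f u * f u"]
        sum_over_enum[of "\<lambda>u. \<Sum>v\<in>verts G. adj_weight u v * f u * f v"])
  finally show ?thesis .
qed

text \<open>Positive degrees make the rescaling invertible; this transfers semidefiniteness from
  functions to all vectors.\<close>

lemma scaled_vec_surj:
  assumes x: "x \<in> carrier_vec (length vs)"
  obtains f where "x = scaled_vec f"
proof
  let ?p = "inv_into {..<length vs} (\<lambda>i. vs ! i)"
  have "?p (vs ! i) = i" if "i < length vs" for i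
    using that vs(1) by (intro inv_into_f_f) (auto simp: inj_on_def nth_eq_iff_index_eq)
  then show "x = scaled_vec (\<lambda>v. x $ ?p v / sqrt (deg v))"
    using x deg_nth_pos by (intro eq_vecI) (auto simp: scaled_vec_def less_imp_neq[symmetric])
qed

text \<open>The constant function yields a kernel vector, and \<open>f\<close> is balanced exactly
  when its rescaling is orthogonal to it. The Rayleigh bounds then apply to
  \<open>ip f f - form f f\<close>, so \<open>form f f\<close> lies between \<open>1 - l1\<close>
  and \<open>1 - l2\<close> times \<open>ip f f\<close>.\<close>

theorem normalized_laplacian_spectral_gap:
  assumes n: "length vs \<ge> 2" and bal: "(\<Sum>v\<in>verts G. deg v * f v) = 0"
  shows "\<bar>form f f\<bar> \<le>
    max \<bar>1 - nth_eigenvalue (normalized_laplacian_mat G vs) 1\<bar>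
        \<bar>1 - nth_eigenvalue (normalized_laplacian_mat G vs) (length vs - 1)\<bar> * ip f f"
proof -
  let ?N = "normalized_laplacian_mat G vs" and ?n = "length vs"
  let ?u = "scaled_vec (\<lambda>_. 1)"
  have u0: "?u \<noteq> 0\<^sub>v ?n"
  proof
    assume eq: "?u = 0\<^sub>v ?n"
    have "0 < ?n" using n by linarith
    then have "?u $ 0 = 0" using eq by simp
    then show False using \<open>0 < ?n\<close> deg_nth_pos[of 0] by (simp add: scaled_vec_def)
  qed
  have Nu: "?N *\<^sub>v ?u = 0\<^sub>v ?n"
  proof (rule eq_vecI)
    fix i assume "i < dim_vec (0\<^sub>v ?n)"
    then have i: "i < ?n" by simp
    have "(?N *\<^sub>v ?u) $ i = sqrt (deg (vs ! i)) - deg (vs ! i) / sqrt (deg (vs ! i))"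
      using normalized_laplacian_mult_scaled_vec[OF i, of "\<lambda>_. 1"] by (simp add: deg_def)
    then show "(?N *\<^sub>v ?u) $ i = 0\<^sub>v ?n $ i"
      using i deg_nth_pos[OF i] by (simp add: real_div_sqrt)
  qed (use normalized_laplacian_mat_carrier in simp)
  have psd: "x \<bullet> (?N *\<^sub>v x) \<ge> 0" if "x \<in> carrier_vec ?n" for x
    using scaled_vec_surj[OF that] scaled_vec_rayleigh ip_minus_form_nonneg by metis
  have orth: "scaled_vec f \<bullet> ?u = 0" using bal by (simp add: scaled_vec_ip ip_def)
  note rayleigh = rayleigh_bounds_orthogonal_to_kernel[OF normalized_laplacian_mat_carrier
      normalized_laplacian_mat_symmetric n psd scaled_vec_carrier u0 Nu scaled_vec_carrier orth,
      unfolded scaled_vec_rayleigh scaled_vec_ip]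
  define l1 l2 where "l1 = nth_eigenvalue ?N 1" and "l2 = nth_eigenvalue ?N (?n - 1)"
  have 1: "form f f \<le> (1 - l2) * ip f f" and 2: "- form f f \<le> - (1 - l1) * ip f f"
    using rayleigh by (auto simp: l1_def l2_def algebra_simps)
  have "(1 - l2) * ip f f \<le> max \<bar>1 - l1\<bar> \<bar>1 - l2\<bar> * ip f f"
    using ip_self_nonneg by (intro mult_right_mono) auto
  moreover have "- (1 - l1) * ip f f \<le> max \<bar>1 - l1\<bar> \<bar>1 - l2\<bar> * ip f f"
    using ip_self_nonneg by (intro mult_right_mono) auto
  ultimately show ?thesis using 1 2 unfolding l1_def l2_def by linarith
qed

end

end

section \<open>The toughness bound\<close>

theorem theorem1p1:
  fixes G :: "('a, 'b) pre_digraph"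
    and vs :: "'a list"
    and n \<Delta> \<delta> :: nat
    and \<xi> :: real
  assumes "graph G"
    and "Digraph_Component.connected G"
    and "n = card (verts G)"
    and "distinct vs" and "set vs = verts G"
    and "\<Delta> = max_degree G"
    and "\<delta> = min_degree G"
    and "\<xi> = max \<bar>1 - nth_eigenvalue (normalized_laplacian_mat G vs) 1\<bar>
                 \<bar>1 - nth_eigenvalue (normalized_laplacian_mat G vs) (n - 1)\<bar>"
  shows "toughness G \<ge>
    ereal (Max {1 / real \<Delta>,
                (real \<Delta> + real \<delta>) / (real \<Delta> * real n),
                real \<delta> * (\<xi> + 1) / (real \<Delta> * \<xi>) - 2})"
proof (cases "complete_digraph (card (verts G)) G")
  case True
  then show ?thesis by (simp add: toughness_def)
next
  case False
  interpret graph G by fact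
  have sc: "strongly_connected G"
    by (rule symmetric_connected_imp_strongly_connected[OF sym_arcs assms(2)])
  define cs where "cs = {S. S \<subseteq> verts G \<and> num_components (del_verts G S) \<ge> 2}"
  define ratio where "ratio S = real (card S) / real (num_components (del_verts G S))" for S
  have "toughness G = ereal (Min (ratio ` cs))"
    using False by (simp add: toughness_def cs_def ratio_def setcompr_eq_image)
  moreover have "finite (ratio ` cs)"
    using finite_subset[of cs "Pow (verts G)"] by (auto simp: cs_def)
  moreover have "ratio ` cs \<noteq> {}" using toughness_set_nonempty[OF False] by (auto simp: cs_def)
  moreover have "Max {1 / real \<Delta>, (real \<Delta> + real \<delta>) / (real \<Delta> * real n),
                real \<delta> * (\<xi> + 1) / (real \<Delta> * \<xi>) - 2} \<le> ratio S" if "S \<in> cs" for S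
  proof -
    have S: "S \<subseteq> verts G" and two: "num_components (del_verts G S) \<ge> 2" using that by (auto simp: cs_def)
    let ?P = "pre_digraph.sccs_verts (del_verts G S)"
    define c where "c = num_components (del_verts G S)"
    have degs: "\<delta> \<le> out_degree G v" "out_degree G v \<le> \<Delta>" if "v \<in> verts G" for v
      using that assms(6,7) by (auto simp: max_degree_def min_degree_def)
    interpret separator "verts G" adj_weight S ?P "real \<delta>"
      by (rule separator_components[OF S two]) (use degs in simp)
    interpret H: sym_digraph "del_verts G S" by (rule sym_digraph_del_verts)
    have cP: "card ?P = c" by (simp add: c_def H.num_components_eq)
    have c2: "c \<ge> 2" using two by (simp add: c_def)
    have n: "c + card S \<le> n" using card_components_le_card by (simp add: cP assms(3))
    have vol: "vol S \<le> real \<Delta> * real (card S)"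
      using vol_le_card[OF S, of "real \<Delta>"] degs by (simp add: deg_eq_out_degree mult.commute)
    have "real c \<le> vol S"
      using card_components_le_vol_S component_edge_to_separator[OF sc S two] by (simp add: cP)
    with vol have "real c \<le> real (\<Delta> * card S)" by simp
    then have cS: "c \<le> \<Delta> * card S" by (simp only: of_nat_le_iff)
    \<comment> \<open>Both factors are positive because \<open>\<Delta> * card S\<close> is at least
      \<open>c\<close>, which is at least 2.\<close>
    have \<Delta>: "\<Delta> > 0" and s: "card S > 0" using cS c2 by (auto intro: gr0I)
    have \<delta>\<Delta>: "\<delta> \<le> \<Delta>"
    proof -
      obtain v where "v \<in> verts G" using S s by fastforce
      then show ?thesis using degs by (meson order_trans)
    qed
    have deg_pos: "deg v > 0" if v: "v \<in> verts G" for v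
    proof -
      \<comment> \<open>As \<open>n \<ge> c \<ge> 2\<close>, there is another vertex, and
        connectivity supplies an arc leaving \<open>{v}\<close>.\<close>
      have "{v} \<noteq> verts G" using n c2 assms(3) by (metis One_nat_def card.empty card_insert_if
            empty_iff finite.emptyI not_less_eq_eq add_leD1 le_trans one_add_one plus_1_eq_Suc)
      then obtain u w where "u \<in> {v}" "w \<in> verts G - {v}" "u \<rightarrow>\<^bsub>G\<^esub> w"
        using strongly_connected_edge_leaving[OF sc, of "{v}"] v by blast
      then have "adj_weight v w = 1" "w \<in> verts G" by auto
      then show ?thesis using member_le_sum[of w "verts G" "adj_weight v"] by (simp add: deg_def)
    qed
    have \<delta>: "\<delta> > 0"
    proof -
      have "\<delta> \<in> out_degree G ` verts G"
        unfolding assms(7) min_degree_def using S s by (intro Min_in) auto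
      then show ?thesis using deg_pos by (auto simp: deg_eq_out_degree)
    qed
    have ratio: "ratio S = real (card S) / real c" by (simp add: ratio_def c_def)
    have bound1: "1 / real \<Delta> \<le> ratio S"
      using cS \<Delta> c2 by (simp add: ratio field_simps flip: of_nat_mult)
    have bound2: "(real \<Delta> + real \<delta>) / (real \<Delta> * real n) \<le> ratio S"
    proof -
      \<comment> \<open>The claim with denominators cleared. For \<open>card S \<ge> 2\<close> it
        follows from \<open>c \<le> n\<close> and \<open>\<delta> \<le> \<Delta>\<close>; a cut
        vertex needs sharper counts, depending on whether \<delta> exceeds 1.\<close>
      have "c * (\<Delta> + \<delta>) \<le> \<Delta> * card S * n"
      proof (cases "card S \<ge> 2")
        case True
        have "c * (\<Delta> + \<delta>) \<le> n * (\<Delta> + \<Delta>)" using n \<delta>\<Delta> by (intro mult_le_mono) auto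
        also have "\<dots> = \<Delta> * 2 * n" by simp
        also have "\<dots> \<le> \<Delta> * card S * n" using True by simp
        finally show ?thesis .
      next
        case False
        then have s1: "card S = 1" using s by simp
        show ?thesis
        proof (cases "\<delta> \<ge> 2")
          case True
          have "2 * c < n" using card_components_cut_vertex[OF s1] True by (simp add: cP assms(3))
          have "c * (\<Delta> + \<delta>) \<le> c * (\<Delta> + \<Delta>)" using \<delta>\<Delta> by simp
          also have "\<dots> = \<Delta> * (2 * c)" by simp
          also have "\<dots> \<le> \<Delta> * n" using \<open>2 * c < n\<close> by (intro mult_le_mono2) simp
          finally show ?thesis by (simp add: s1)
        next
          case False
          then have "\<delta> = 1" using \<delta> by simp
          \<comment> \<open>Here \<open>c \<le> \<Delta>\<close>, so
            \<open>c * (\<Delta> + 1)\<close> is at most \<open>\<Delta> * (c + 1)\<close>.\<close>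
          moreover have "\<Delta> * (c + 1) \<le> \<Delta> * n" using n s1 by (intro mult_le_mono2) simp
          ultimately show ?thesis using cS by (simp add: s1 algebra_simps)
        qed
      qed
      then have "real (c * (\<Delta> + \<delta>)) \<le> real (\<Delta> * card S * n)" by (simp only: of_nat_le_iff)
      moreover have "n > 0" using n c2 by simp
      ultimately show ?thesis using \<Delta> c2 by (simp add: ratio field_simps)
    qed
    have bound3: "real \<delta> * (\<xi> + 1) / (real \<Delta> * \<xi>) - 2 \<le> ratio S"
    proof -
      have ratio_nonneg: "ratio S \<ge> 0" by (simp add: ratio)
      have xi0: "\<xi> \<ge> 0" using assms(8) by simp
      consider "\<xi> = 0" | "\<xi> \<ge> 1" | "0 < \<xi>" "\<xi> < 1" using xi0 by linarith
      then show ?thesis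
      proof cases
        case 1
        \<comment> \<open>Division by zero yields 0, so the bound reads
          \<open>- 2 \<le> ratio S\<close>.\<close>
        then show ?thesis using ratio_nonneg by simp
      next
        case 2
        \<comment> \<open>For \<open>\<xi> \<ge> 1\<close> the third bound is at most 0.\<close>
        have "real \<delta> * (\<xi> + 1) \<le> real \<Delta> * (2 * \<xi>)" using \<delta>\<Delta> 2 by (intro mult_mono) auto
        then have "real \<delta> * (\<xi> + 1) / (real \<Delta> * \<xi>) \<le> 2" using \<Delta> 2 by (simp add: divide_le_eq)
        then show ?thesis using ratio_nonneg by linarith
      next
        case 3
        have len: "length vs = n" using assms(3-5) distinct_card by metis
        have volV: "vol (verts G) > 0" unfolding vol_def using deg_pos S s by (intro sum_pos) auto
        interpret expander_separator "verts G" adj_weight \<xi> S ?P "real \<delta>"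
        proof unfold_locales
          show "\<bar>form f f\<bar> \<le> \<xi> * ip f f" if "(\<Sum>v\<in>verts G. deg v * f v) = 0" for f
            using normalized_laplacian_spectral_gap[OF assms(4,5) deg_pos _ that] n c2 len assms(8) by simp
        qed (use 3 \<delta> volV in auto)
        have "real c * real \<delta> * (1 - \<xi>) \<le> \<xi> * vol S" using separator_volume by (simp add: cP)
        also have "\<dots> \<le> \<xi> * (real \<Delta> * real (card S))" using vol 3 by (intro mult_left_mono) auto
        finally have "real \<delta> * (1 - \<xi>) / (real \<Delta> * \<xi>) \<le> ratio S"
          using \<Delta> c2 3 by (simp add: ratio field_simps)
        \<comment> \<open>The two numerators on the \<delta> side differ by
          \<open>2 * \<delta> * \<xi>\<close>, and \<open>\<delta> \<le> \<Delta>\<close> lets the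
          term 2 absorb the difference.\<close>
        moreover have "real \<delta> * (\<xi> + 1) / (real \<Delta> * \<xi>) - 2 \<le> real \<delta> * (1 - \<xi>) / (real \<Delta> * \<xi>)"
        proof -
          have "real \<delta> * (\<xi> + 1) - 2 * (real \<Delta> * \<xi>) \<le> real \<delta> * (1 - \<xi>)"
            using mult_right_mono[of "real \<delta>" "real \<Delta>" \<xi>] \<delta>\<Delta> 3 by (simp add: algebra_simps)
          then have "(real \<delta> * (\<xi> + 1) - 2 * (real \<Delta> * \<xi>)) / (real \<Delta> * \<xi>) \<le> real \<delta> * (1 - \<xi>) / (real \<Delta> * \<xi>)"
            using \<Delta> 3 by (intro divide_right_mono) auto
          then show ?thesis using \<Delta> 3 by (simp add: diff_divide_distrib)
        qed
        ultimately show ?thesis by linarith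
      qed
    qed
    show ?thesis using bound1 bound2 bound3 by simp
  qed
  ultimately show ?thesis by (simp add: Min_ge_iff)
qed

end
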